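(* Let $\Gamma$ be a finitely generated extraterrestrial group. Then there exists a finite alphabet $\Lambda$ and a $\Gamma$-subshift $X\subseteq\Lambda^{\Gamma}$ which is effectively closed by patterns and which is not a topological factor of any $\Gamma$-subshift of finite type.
   Context: For a finite alphabet $\Sigma$ and group $\Gamma$, $\Sigma^\Gamma$ carries the product (prodiscrete) topology and the shift action $(gx)(h)=x(g^{-1}h)$. A $\Gamma$-subshift is a closed shift-invariant subset. A subshift of finite type (SFT) is a set of the form $\Sigma^\Gamma\setminus\bigcup_{p\in\mathcal F,g\in\Gamma}g[p]$ for a finite set $\mathcal F$ of patterns (maps $p:D\to\Sigma$ with $D\subset\Gamma$ finite, $[p]=\{x: x|_D=p\}$). A topological factor map between subshifts is a continuous, shift-equivariant surjection. Fix a finite symmetric generating set $S$ of $\Gamma$; for a word $w\in S^*$ let $\underline w\in\Gamma$ be the element it represents. A pattern coding is a map $c:W\to\Sigma$ with $W\subset S^*$ finite; its cylinder is $[c]=\bigcap_{w\in W}\{x: x(\underline w)=c(w)\}$. A subshift $X\subseteq\Sigma^\Gamma$ is effectively closed by patterns if there is a recursively enumerable set $\mathcal C$ of pattern codings with $X=\Sigma^\Gamma\setminus\bigcup_{c\in\mathcal C,g\in\Gamma}g[c]$. A finitely generated group is extraterrestrial if its Cayley graph $\mathrm{Cay}(\Gamma,S)$ (vertices $\Gamma$, edges $\{g,gs\}$, $s\in S$) is extraterrestrial for some (equivalently every) finite symmetric generating set $S$, where a graph $G=(V,E)$ is extraterrestrial if for every $m$ there is $k$ such that for every $r$ there is an $(m,k,r)$-UFO: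 pairwise disjoint finite $U,F,O\subseteq V$ with $U\neq\emptyset$, $|U|\ge m|F|$, a bijection $U\to O$ moving each vertex by graph distance at most $k$, and every path (sequence of distinct consecutive-adjacent vertices) from $U$ to $O$ either meets $F$ or has length at least $r$. *)

theory Defs
  imports Main "HOL-Library.Nat_Bijection"
begin

datatype recf = Zf | Sf | Idf nat | Cnf recf "recf list" | Prf recf recf | Mnf recf

inductive reval :: "recf \<Rightarrow> nat list \<Rightarrow> nat \<Rightarrow> bool" where
  zero: "reval Zf xs 0"
| succ: "reval Sf [x] (Suc x)"
| proj: "i < length xs \<Longrightarrow> reval (Idf i) xs (xs ! i)"
| comp: "list_all2 (\<lambda>g y. reval g xs y) gs ys \<Longrightarrow> reval f ys z \<Longrightarrow> reval (Cnf f gs) xs z"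
| pr0: "reval f xs y \<Longrightarrow> reval (Prf f g) (0 # xs) y"
| prS: "reval (Prf f g) (k # xs) r \<Longrightarrow> reval g (k # r # xs) y \<Longrightarrow> reval (Prf f g) (Suc k # xs) y"
| mn: "reval f (k # xs) 0 \<Longrightarrow> (\<forall>i<k. \<exists>y. reval f (i # xs) y \<and> 0 < y) \<Longrightarrow> reval (Mnf f) xs k"

definition re_set :: "nat set \<Rightarrow> bool" where
  "re_set A \<longleftrightarrow> (\<exists>f. \<forall>a. a \<in> A \<longleftrightarrow> (\<exists>y. reval f [a] y))"

definition walk :: "('v \<Rightarrow> 'v \<Rightarrow> bool) \<Rightarrow> 'v list \<Rightarrow> bool" where
  "walk adj xs \<longleftrightarrow> xs \<noteq> [] \<and> (\<forall>i. Suc i < length xs \<longrightarrow> adj (xs ! i) (xs ! Suc i))"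

definition gpath :: "('v \<Rightarrow> 'v \<Rightarrow> bool) \<Rightarrow> 'v list \<Rightarrow> bool" where
  "gpath adj xs \<longleftrightarrow> walk adj xs \<and> distinct xs"

definition dist_le :: "('v \<Rightarrow> 'v \<Rightarrow> bool) \<Rightarrow> 'v \<Rightarrow> 'v \<Rightarrow> nat \<Rightarrow> bool" where
  "dist_le adj u v k \<longleftrightarrow> (\<exists>xs. walk adj xs \<and> hd xs = u \<and> last xs = v \<and> length xs \<le> Suc k)"

definition is_UFO :: "('v \<Rightarrow> 'v \<Rightarrow> bool) \<Rightarrow> nat \<Rightarrow> nat \<Rightarrow> nat \<Rightarrow> 'v set \<Rightarrow> 'v set \<Rightarrow> 'v set \<Rightarrow> bool" where
  "is_UFO adj m k r U F Ob \<longleftrightarrow>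
     finite U \<and> finite F \<and> finite Ob \<and>
     U \<inter> F = {} \<and> U \<inter> Ob = {} \<and> F \<inter> Ob = {} \<and>
     U \<noteq> {} \<and> card U \<ge> m * card F \<and>
     (\<exists>f. bij_betw f U Ob \<and> (\<forall>u\<in>U. dist_le adj u (f u) k)) \<and>
     (\<forall>p. gpath adj p \<longrightarrow> hd p \<in> U \<longrightarrow> last p \<in> Ob \<longrightarrow>
          set p \<inter> F \<noteq> {} \<or> length p - 1 \<ge> r)"

definition extraterrestrial_graph :: "('v \<Rightarrow> 'v \<Rightarrow> bool) \<Rightarrow> bool" where
  "extraterrestrial_graph adj \<longleftrightarrow>
     (\<forall>m. \<exists>k. \<forall>r. \<exists>U F Ob. is_UFO adj m k r U F Ob)"

definition symmetric_set :: "'g::group_add set \<Rightarrow> bool" where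
  "symmetric_set S \<longleftrightarrow> (\<forall>s\<in>S. - s \<in> S)"

definition generates :: "'g::group_add set \<Rightarrow> bool" where
  "generates S \<longleftrightarrow> (\<forall>g::'g. \<exists>xs. set xs \<subseteq> S \<union> uminus ` S \<and> g = sum_list xs)"

definition fin_sym_gen :: "'g::group_add set \<Rightarrow> bool" where
  "fin_sym_gen S \<longleftrightarrow> finite S \<and> symmetric_set S \<and> generates S"

definition cayley_adj :: "'g::group_add set \<Rightarrow> 'g \<Rightarrow> 'g \<Rightarrow> bool" where
  "cayley_adj S u v \<longleftrightarrow> (\<exists>s\<in>S. v = u + s \<or> u = v + s)"

definition finitely_generated :: "'g::group_add itself \<Rightarrow> bool" where
  "finitely_generated _ \<longleftrightarrow> (\<exists>S::'g set. finite S \<and> generates S)"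

definition extraterrestrial_group :: "'g::group_add itself \<Rightarrow> bool" where
  "extraterrestrial_group _ \<longleftrightarrow>
     (\<exists>S::'g set. fin_sym_gen S \<and> extraterrestrial_graph (cayley_adj S))"

definition conf :: "nat \<Rightarrow> ('g \<Rightarrow> nat) set" where
  "conf n = {x. \<forall>g. x g < n}"

definition shift :: "'g::group_add \<Rightarrow> ('g \<Rightarrow> 'a) \<Rightarrow> ('g \<Rightarrow> 'a)" where
  "shift g x = (\<lambda>h. x (- g + h))"

text \<open>closedness in the prodiscrete topology\<close>
definition pd_closed :: "nat \<Rightarrow> ('g \<Rightarrow> nat) set \<Rightarrow> bool" where
  "pd_closed n X \<longleftrightarrow> (\<forall>x\<in>conf n. (\<forall>D. finite D \<longrightarrow> (\<exists>y\<in>X. \<forall>h\<in>D. y h = x h)) \<longrightarrow> x \<in> X)"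

definition subshift :: "nat \<Rightarrow> ('g::group_add \<Rightarrow> nat) set \<Rightarrow> bool" where
  "subshift n X \<longleftrightarrow> X \<subseteq> conf n \<and> pd_closed n X \<and> (\<forall>g. \<forall>x\<in>X. shift g x \<in> X)"

definition in_shifted_cyl :: "('g::group_add \<Rightarrow> nat) \<Rightarrow> 'g \<Rightarrow> 'g set \<Rightarrow> ('g \<Rightarrow> nat) \<Rightarrow> bool" where
  "in_shifted_cyl x g D p \<longleftrightarrow> x \<in> shift g ` {y. \<forall>h\<in>D. y h = p h}"

definition SFT :: "nat \<Rightarrow> ('g::group_add \<Rightarrow> nat) set \<Rightarrow> bool" where
  "SFT n Y \<longleftrightarrow> (\<exists>\<F>::('g set \<times> ('g \<Rightarrow> nat)) set. finite \<F> \<and> (\<forall>(D,p)\<in>\<F>. finite D) \<and>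
      Y = conf n - (\<Union>(D,p)\<in>\<F>. \<Union>g. {x. in_shifted_cyl x g D p}))"

text \<open>continuity w.r.t. the prodiscrete topologies (finite target alphabet)\<close>
definition pd_continuous_on :: "('g \<Rightarrow> nat) set \<Rightarrow> (('g \<Rightarrow> nat) \<Rightarrow> ('g \<Rightarrow> nat)) \<Rightarrow> bool" where
  "pd_continuous_on Y \<phi> \<longleftrightarrow> (\<forall>y\<in>Y. \<forall>g. \<exists>D. finite D \<and>
      (\<forall>y'\<in>Y. (\<forall>h\<in>D. y' h = y h) \<longrightarrow> \<phi> y' g = \<phi> y g))"

definition factor_map :: "('g::group_add \<Rightarrow> nat) set \<Rightarrow> ('g \<Rightarrow> nat) set \<Rightarrow> (('g \<Rightarrow> nat) \<Rightarrow> ('g \<Rightarrow> nat)) \<Rightarrow> bool" where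
  "factor_map Y X \<phi> \<longleftrightarrow> pd_continuous_on Y \<phi> \<and> (\<forall>g. \<forall>y\<in>Y. \<phi> (shift g y) = shift g (\<phi> y)) \<and> \<phi> ` Y = X"

text \<open>The finite symmetric generating set S is fixed as a list ss of distinct elements; a word in S^*
  is a list of indices < length ss. A pattern coding W -> alphabet is coded as a natural number:
  list_decode gives a list of codes of pairs (word code, symbol); word codes are list_decoded.\<close>

definition word_elem :: "'g::group_add list \<Rightarrow> nat list \<Rightarrow> 'g" where
  "word_elem ss w = sum_list (map (\<lambda>i. ss ! i) w)"

definition decode_coding :: "nat \<Rightarrow> (nat list \<times> nat) list" where
  "decode_coding a = map (\<lambda>c. (list_decode (fst (prod_decode c)), snd (prod_decode c))) (list_decode a)"

definition valid_coding :: "'g list \<Rightarrow> nat \<Rightarrow> bool" where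
  "valid_coding ss a \<longleftrightarrow> (\<forall>(w,\<sigma>)\<in>set (decode_coding a). \<forall>i\<in>set w. i < length ss)"

definition in_shifted_coding_cyl :: "'g::group_add list \<Rightarrow> ('g \<Rightarrow> nat) \<Rightarrow> 'g \<Rightarrow> nat \<Rightarrow> bool" where
  "in_shifted_coding_cyl ss x g a \<longleftrightarrow>
     x \<in> shift g ` {y. \<forall>(w,\<sigma>)\<in>set (decode_coding a). y (word_elem ss w) = \<sigma>}"

definition eff_closed_by_patterns :: "'g::group_add list \<Rightarrow> nat \<Rightarrow> ('g \<Rightarrow> nat) set \<Rightarrow> bool" where
  "eff_closed_by_patterns ss n X \<longleftrightarrow> (\<exists>C. re_set C \<and> (\<forall>a\<in>C. valid_coding ss a) \<and>
      X = conf n - (\<Union>a\<in>C. \<Union>g. {x. in_shifted_coding_cyl ss x g a}))"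

end

theory Submission
  imports Defs "HOL-Library.Infinite_Set" "HOL-Library.FuncSet"
begin

text \<open>Enumerate the group as \<open>e 0, e 1, \<dots>\<close>. Two sets \<open>A\<close> (sources) and \<open>B\<close> (targets) are matched greedily:
  at stage \<open>i\<close>, each \<open>g \<in> A\<close> is joined to \<open>g + e i \<in> B\<close> unless one of the two was joined at an earlier
  stage. Stage \<open>i\<close> depends only on a finite window, and among the pairs at bounded distance the greedy
  matching attains at least half of any matching. The subshift \<open>X\<close> consists of the configurations of
  sources and targets, each carrying a bit, whose matched pairs carry equal bits.

  Suppose that \<open>X\<close> is a factor of an SFT \<open>Y\<close>. For an \<open>(m,k,r)\<close>-UFO \<open>(U,F,O)\<close> with \<open>m\<close> large, the bits on the
  matched part of \<open>U\<close> are free, so by pigeonhole two preimages agree on a neighbourhood of \<open>F\<close> although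
  their images differ at some matched \<open>u \<in> U\<close>. Translate \<open>u\<close> to the origin; since \<open>k\<close> does not depend on \<open>r\<close>,
  the stage of the match is bounded, and one may pass to a limit as \<open>r \<rightarrow> \<infinity>\<close>. In the limit \<open>F\<close> separates the
  origin from its partner, so one preimage on the component of the origin can be glued to the other
  preimage outside. The glued point lies in \<open>Y\<close>, but its image violates the rule of \<open>X\<close>.

  A violation of the rule is witnessed by finitely many symbols and a finite computation on formal words,
  which does not need the word problem: if two words represent the same element but the pattern gives them
  different symbols, its cylinder is empty.\<close>

section \<open>Greedy matchings\<close>

text \<open>The source that could have been joined to \<open>g + e i\<close> at stage
  \<open>j\<close> is \<open>g + e i - e j\<close>. The quantifiers range over the set
  \<open>{..<i}\<close>, so that \<open>j < i\<close> is available for the recursive calls in the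
  termination proof.\<close>

function greedy :: "(nat \<Rightarrow> 'g::group_add) \<Rightarrow> 'g set \<Rightarrow> 'g set \<Rightarrow> 'g \<Rightarrow> nat \<Rightarrow> bool" where
  "greedy e A B g i \<longleftrightarrow> g \<in> A \<and> g + e i \<in> B \<and> (\<forall>j\<in>{..<i}. \<not> greedy e A B g j) \<and>
     (\<forall>j\<in>{..<i}. \<not> greedy e A B (g + e i - e j) j)"
  by pat_completeness auto
termination by (relation "measure (\<lambda>(e, A, B, g, i). i)") auto

declare greedy.simps [simp del]

lemma greedyD: "greedy e A B g i \<Longrightarrow> g \<in> A" "greedy e A B g i \<Longrightarrow> g + e i \<in> B"
  by (simp_all add: greedy.simps[of e A B g i])

lemma greedy_unique:
  assumes "greedy e A B g i" "greedy e A B g j"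
  shows "i = j"
  using assms by (metis greedy.simps lessThan_iff linorder_neqE_nat)

lemma greedy_inj:
  assumes "greedy e A B g i" "greedy e A B h j" "g + e i = h + e j"
  shows "g = h"
proof -
  \<comment> \<open>If \<open>i' < j'\<close>, the pair joined at stage \<open>i'\<close> already
    occupies the common target and blocks the pair of stage \<open>j'\<close>.\<close>
  have *: "i' \<ge> j'" if "greedy e A B g' i'" "greedy e A B h' j'" "g' + e i' = h' + e j'" for g' h' i' j'
  proof (rule ccontr)
    assume "\<not> j' \<le> i'"
    moreover have "g' = h' + e j' - e i'" using that(3) by (metis add_diff_cancel)
    ultimately show False
      using that(1,2) greedy.simps[of e A B h' j'] by auto
  qed
  have "i = j" using *[OF assms] *[OF assms(2,1) assms(3)[symmetric]] by simp
  then show ?thesis using assms(3) by simp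
qed

text \<open>Every test of the recursion is made relative to \<open>g\<close>. This yields shift
  invariance of the copying rule and lets a UFO be moved to the origin.\<close>

lemma greedy_translate:
  "greedy e A B (u + g) i \<longleftrightarrow> greedy e {h. u + h \<in> A} {h. u + h \<in> B} g i"
proof (induction i arbitrary: g rule: less_induct)
  case (less i)
  have "u + g + e i - e j = u + (g + e i - e j)" for j
    by (metis add.assoc add_diff_eq)
  with less show ?case
    by (subst (1 2) greedy.simps) (simp add: add.assoc)
qed

text \<open>The window of stage \<open>i\<close> adds to \<open>{0, e i}\<close> the windows of all
  earlier stages, around \<open>g\<close> and around each \<open>g + e i - e j\<close>. It is chosen
  before \<open>g\<close> and the two sets, so it also serves for limits of configurations.\<close>

lemma greedy_local:
  "\<exists>D. finite D \<and> (\<forall>A B A' B' g. (\<forall>h\<in>D. (g + h \<in> A \<longleftrightarrow> g + h \<in> A') \<and> (g + h \<in> B \<longleftrightarrow> g + h \<in> B')) \<longrightarrow>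
     greedy e A B g i = greedy e A' B' g i)"
proof (induction i rule: less_induct)
  case (less i)
  then obtain D where D: "\<And>j. j < i \<Longrightarrow> finite (D j)"
    "\<And>j A B A' B' g. j < i \<Longrightarrow> \<forall>h\<in>D j. (g + h \<in> A \<longleftrightarrow> g + h \<in> A') \<and> (g + h \<in> B \<longleftrightarrow> g + h \<in> B') \<Longrightarrow>
     greedy e A B g j = greedy e A' B' g j"
    by metis
  let ?D = "{0, e i} \<union> (\<Union>j\<in>{..<i}. D j) \<union> (\<Union>j\<in>{..<i}. (\<lambda>h. e i - e j + h) ` D j)"
  have "greedy e A B g i = greedy e A' B' g i"
    if *: "\<forall>h\<in>?D. (g + h \<in> A \<longleftrightarrow> g + h \<in> A') \<and> (g + h \<in> B \<longleftrightarrow> g + h \<in> B')" for A B A' B' g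
  proof -
    have "g + 0 \<in> A \<longleftrightarrow> g + 0 \<in> A'" "g + e i \<in> B \<longleftrightarrow> g + e i \<in> B'" using * by blast+
    moreover have "greedy e A B g j = greedy e A' B' g j" if "j < i" for j
      using that * by (intro D(2)) auto
    moreover have "greedy e A B (g + e i - e j) j = greedy e A' B' (g + e i - e j) j" if "j < i" for j
    proof (intro D(2) that ballI)
      fix h assume "h \<in> D j"
      then have "e i - e j + h \<in> ?D" using that by blast
      note bspec[OF * this]
      moreover have "g + e i - e j + h = g + (e i - e j + h)" by (metis add.assoc add_diff_eq)
      ultimately show "(g + e i - e j + h \<in> A) = (g + e i - e j + h \<in> A') \<and>
          (g + e i - e j + h \<in> B) = (g + e i - e j + h \<in> B')" by (simp only:)
    qed
    ultimately show ?thesis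
      by (subst (1 2) greedy.simps) auto
  qed
  moreover have "finite ?D" using D(1) by auto
  ultimately show ?case by (intro exI[of _ ?D] conjI allI impI)
qed

text \<open>If the pair \<open>u\<close>, \<open>f u\<close> is not joined at its stage, one of its
  ends was joined earlier. So each \<open>u\<close> is matched or has a matched partner
  \<open>f u\<close>; as \<open>f\<close> is injective and there are at most as many matched targets
  as matched sources, each alternative accounts for at most \<open>card ?M\<close> elements.\<close>

lemma card_greedy_half:
  assumes "finite U" "bij_betw f U B" "\<And>u. u \<in> U \<Longrightarrow> \<exists>i<K. f u = u + e i"
  shows "card U \<le> 2 * card {u. \<exists>i<K. greedy e U B u i}"
proof -
  let ?M = "{u. \<exists>i<K. greedy e U B u i}"
  let ?O = "{v. \<exists>u i. i < K \<and> greedy e U B u i \<and> v = u + e i}"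
  define ix where "ix u = (THE i. greedy e U B u i)" for u
  have ix: "ix u = i" if "greedy e U B u i" for u i
    unfolding ix_def using that greedy_unique by blast
  have fin: "finite ?M" by (rule finite_subset[OF _ assms(1)]) (auto dest: greedyD)
  have O: "?O \<subseteq> (\<lambda>u. u + e (ix u)) ` ?M"
    using ix by blast
  have "U \<subseteq> ?M \<union> {u\<in>U. f u \<in> ?O}"
  proof
    fix u assume u: "u \<in> U"
    then obtain i where i: "i < K" "f u = u + e i" using assms(3) by blast
    have fu: "f u \<in> B" using u assms(2) by (auto simp: bij_betw_def)
    show "u \<in> ?M \<union> {u\<in>U. f u \<in> ?O}"
    proof (cases "greedy e U B u i")
      case True
      then show ?thesis using i by blast
    next
      case False
      then obtain j where j: "j < i" "greedy e U B u j \<or> greedy e U B (u + e i - e j) j"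
        using u fu i(2) greedy.simps[of e U B u i] by auto
      from j(2) show ?thesis
      proof
        assume "greedy e U B u j"
        then show ?thesis using j(1) i(1) by (auto intro: less_trans)
      next
        assume "greedy e U B (u + e i - e j) j"
        moreover have "u + e i = u + e i - e j + e j" by simp
        ultimately have "f u \<in> ?O" unfolding i(2) using j(1) i(1) less_trans by blast
        then show ?thesis using u by blast
      qed
    qed
  qed
  then have "card U \<le> card (?M \<union> {u\<in>U. f u \<in> ?O})"
    using fin assms(1) by (intro card_mono) auto
  also have "\<dots> \<le> card ?M + card {u\<in>U. f u \<in> ?O}" by (rule card_Un_le)
  also have "card {u\<in>U. f u \<in> ?O} \<le> card ?O"
    using assms(2) finite_subset[OF O finite_imageI[OF fin]]
    by (intro card_inj_on_le[where f = f]) (auto simp: bij_betw_def inj_on_def)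
  also have "card ?O \<le> card ?M"
    using card_mono[OF finite_imageI[OF fin] O] card_image_le[OF fin] order_trans by blast
  finally show ?thesis by simp
qed

section \<open>The copying subshift\<close>

definition src :: "('g \<Rightarrow> nat) \<Rightarrow> 'g set" where "src x = {g. x g \<in> {1, 2}}"
definition tgt :: "('g \<Rightarrow> nat) \<Rightarrow> 'g set" where "tgt x = {g. x g \<in> {3, 4}}"

text \<open>The symbols 1, 2 are sources with bit 0, 1; the symbols 3, 4 are targets with bit 0, 1; 0 is blank.\<close>

definition copy_shift :: "(nat \<Rightarrow> 'g::group_add) \<Rightarrow> ('g \<Rightarrow> nat) set" where
  "copy_shift e = {x \<in> conf 5. \<forall>g i. greedy e (src x) (tgt x) g i \<longrightarrow> x (g + e i) = x g + 2}"

text \<open>Each single constraint reads only a finite window, by \<open>greedy_local\<close>, so it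
  survives limits. Shift invariance is \<open>greedy_translate\<close>.\<close>

lemma subshift_copy_shift: "subshift 5 (copy_shift e)"
  unfolding subshift_def
proof (intro conjI allI ballI)
  show "copy_shift e \<subseteq> conf 5" by (auto simp: copy_shift_def)
  show "pd_closed 5 (copy_shift e)"
    unfolding pd_closed_def
  proof (intro ballI impI)
    fix x assume x: "x \<in> conf 5" "\<forall>D. finite D \<longrightarrow> (\<exists>y\<in>copy_shift e. \<forall>h\<in>D. y h = x h)"
    have "x (g + e i) = x g + 2" if gr: "greedy e (src x) (tgt x) g i" for g i
    proof -
      obtain D where D: "finite D"
        "\<And>A B A' B' g. \<forall>h\<in>D. (g + h \<in> A \<longleftrightarrow> g + h \<in> A') \<and> (g + h \<in> B \<longleftrightarrow> g + h \<in> B') \<Longrightarrow>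
           greedy e A B g i = greedy e A' B' g i"
        using greedy_local[of e i] by metis
      have "finite ((\<lambda>h. g + h) ` D \<union> {g, g + e i})" using D(1) by simp
      then obtain y where y: "y \<in> copy_shift e" "\<forall>h\<in>(\<lambda>h. g + h) ` D \<union> {g, g + e i}. y h = x h"
        using x(2) by blast
      have "greedy e (src y) (tgt y) g i = greedy e (src x) (tgt x) g i"
        using y(2) by (intro D(2)) (auto simp: src_def tgt_def)
      then have "y (g + e i) = y g + 2" using gr y(1) by (auto simp: copy_shift_def)
      then show ?thesis using y(2) by simp
    qed
    then show "x \<in> copy_shift e" using x(1) by (simp add: copy_shift_def)
  qed
  fix g x assume x: "x \<in> copy_shift e"
  have "shift g x (h + e i) = shift g x h + 2" if "greedy e (src (shift g x)) (tgt (shift g x)) h i" for h i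
  proof -
    have "greedy e (src x) (tgt x) (- g + h) i"
      using that by (simp add: greedy_translate src_def tgt_def shift_def)
    then have "x (- g + h + e i) = x (- g + h) + 2" using x by (simp add: copy_shift_def)
    then show ?thesis by (simp add: shift_def add.assoc)
  qed
  then show "shift g x \<in> copy_shift e"
    using x by (simp add: copy_shift_def conf_def) (simp add: shift_def)
qed

text \<open>The set \<open>p\<close> lists the sources with bit 1. A matched target copies its
  source, an unmatched one gets bit 0 by default.\<close>

definition copy_config :: "(nat \<Rightarrow> 'g::group_add) \<Rightarrow> 'g set \<Rightarrow> 'g set \<Rightarrow> 'g set \<Rightarrow> 'g \<Rightarrow> nat" where
  "copy_config e U B p g =
     (if g \<in> U then (if g \<in> p then 2 else 1)
      else if g \<in> B then (if \<exists>u\<in>p. \<exists>i. greedy e U B u i \<and> g = u + e i then 4 else 3)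
      else 0)"

lemma src_copy_config: "src (copy_config e U B p) = U"
  and tgt_copy_config: "U \<inter> B = {} \<Longrightarrow> tgt (copy_config e U B p) = B"
  by (auto simp: src_def tgt_def copy_config_def split: if_splits)

lemma copy_config_in_copy_shift:
  assumes "U \<inter> B = {}"
  shows "copy_config e U B p \<in> copy_shift e"
proof -
  have "copy_config e U B p (g + e i) = copy_config e U B p g + 2" if gr: "greedy e U B g i" for g i
  proof -
    have "g \<in> U" "g + e i \<in> B" "g + e i \<notin> U" using greedyD[OF gr] assms by auto
    \<comment> \<open>By \<open>greedy_inj\<close> the target \<open>g + e i\<close> has no source
      besides \<open>g\<close>, so its bit is that of \<open>g\<close>.\<close>
    moreover have "(\<exists>u\<in>p. \<exists>j. greedy e U B u j \<and> g + e i = u + e j) \<longleftrightarrow> g \<in> p"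
      using gr greedy_inj by metis
    ultimately show ?thesis by (simp add: copy_config_def)
  qed
  moreover have "copy_config e U B p \<in> conf 5" by (auto simp: conf_def copy_config_def)
  ultimately show ?thesis
    by (simp add: copy_shift_def src_copy_config tgt_copy_config[OF assms])
qed

section \<open>Compactness\<close>

text \<open>Cantor's diagonal argument: on the infinite index set \<open>T n\<close> the coordinates
  \<open>e 0\<close>, ..., \<open>e (n - 1)\<close> are constant. No convergent subsequence is
  extracted; it is enough that every finite window of the limit recurs at arbitrarily late
  indices.\<close>

lemma pointwise_cluster_point:
  fixes z :: "nat \<Rightarrow> 'h \<Rightarrow> 'c" and e :: "nat \<Rightarrow> 'h"
  assumes e: "range e = UNIV" and "finite A" and z: "\<And>n h. z n h \<in> A"
  obtains z' where "\<And>D n. finite D \<Longrightarrow> \<exists>r\<ge>n. \<forall>h\<in>D. z r h = z' h"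
proof -
  have "\<exists>T. \<forall>n. infinite (T n) \<and> (T (Suc n) \<subseteq> T n \<and> (\<exists>c. \<forall>r\<in>T (Suc n). z r (e n) = c))"
  proof (rule dependent_nat_choice)
    show "\<exists>x. infinite (x :: nat set)" using infinite_UNIV_nat by blast
    fix S :: "nat set" and n assume "infinite S"
    moreover have "finite ((\<lambda>r. z r (e n)) ` S)" using z \<open>finite A\<close> by (meson finite_subset image_subsetI)
    ultimately obtain a where "infinite {r\<in>S. z r (e n) = z a (e n)}"
      using pigeonhole_infinite by blast
    then show "\<exists>y. infinite y \<and> y \<subseteq> S \<and> (\<exists>c. \<forall>r\<in>y. z r (e n) = c)"
      by (intro exI[of _ "{r\<in>S. z r (e n) = z a (e n)}"]) auto
  qed
  then obtain T where inf: "\<And>n. infinite (T n)" and sub: "\<And>n. T (Suc n) \<subseteq> T n"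
    and "\<And>n. \<exists>c. \<forall>r\<in>T (Suc n). z r (e n) = c" by blast
  then obtain c where c: "\<And>n r. r \<in> T (Suc n) \<Longrightarrow> z r (e n) = c n" by metis
  \<comment> \<open>The enumeration \<open>e\<close> may repeat elements, so one index is selected
    for each.\<close>
  define ix where "ix h = (SOME n. e n = h)" for h
  have ix: "e (ix h) = h" for h
    unfolding ix_def by (rule someI_ex) (metis e rangeE UNIV_I)
  have "\<exists>r\<ge>n. \<forall>h\<in>D. z r h = c (ix h)" if fin: "finite D" for D n
  proof -
    obtain k where k: "\<And>h. h \<in> D \<Longrightarrow> ix h < k"
      using finite_imageI[OF fin, of ix] unfolding finite_nat_set_iff_bounded by auto
    obtain r where r: "r \<ge> n" "r \<in> T k"
      using inf[of k] by (metis infinite_nat_iff_unbounded_le)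
    have "z r h = c (ix h)" if "h \<in> D" for h
    proof -
      have "T k \<subseteq> T (Suc (ix h))"
        using k[OF that] lift_Suc_antimono_le[of T, OF sub] by simp
      then show ?thesis using c[of r "ix h"] r(2) by (auto simp: ix)
    qed
    then show ?thesis using r(1) by blast
  qed
  then show ?thesis by (rule that)
qed

section \<open>Subshifts of finite type and their factor maps\<close>

lemma in_shifted_cyl_iff: "in_shifted_cyl x g D p \<longleftrightarrow> (\<forall>h\<in>D. x (g + h) = p h)"
proof
  assume "\<forall>h\<in>D. x (g + h) = p h"
  moreover have "x = shift g (\<lambda>h. x (g + h))" by (simp add: shift_def add.assoc[symmetric])
  ultimately show "in_shifted_cyl x g D p" unfolding in_shifted_cyl_def by blast
qed (auto simp: in_shifted_cyl_def shift_def add.assoc[symmetric])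

lemma SFT_iff:
  "SFT n Y \<longleftrightarrow> (\<exists>\<F>. finite \<F> \<and> (\<forall>(D, p)\<in>\<F>. finite D) \<and>
    (\<forall>x. x \<in> Y \<longleftrightarrow> x \<in> conf n \<and> (\<forall>g. \<forall>(D, p)\<in>\<F>. \<exists>h\<in>D. x (g + h) \<noteq> p h)))"
proof -
  have "Y = conf n - (\<Union>(D,p)\<in>\<F>. \<Union>g. {x. in_shifted_cyl x g D p}) \<longleftrightarrow>
    (\<forall>x. x \<in> Y \<longleftrightarrow> x \<in> conf n \<and> (\<forall>g. \<forall>(D, p)\<in>\<F>. \<exists>h\<in>D. x (g + h) \<noteq> p h))" for \<F>
    unfolding set_eq_iff by (simp add: in_shifted_cyl_iff split_beta) blast
  then show ?thesis unfolding SFT_def by simp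
qed

lemma SFT_shift:
  assumes "SFT n Y" "y \<in> Y"
  shows "shift g y \<in> Y"
proof -
  obtain \<F> where F: "\<And>x. x \<in> Y \<longleftrightarrow> x \<in> conf n \<and> (\<forall>g. \<forall>(D, p)\<in>\<F>. \<exists>h\<in>D. x (g + h) \<noteq> p h)"
    using assms(1) unfolding SFT_iff by auto
  have "\<forall>k. \<forall>(D, p)\<in>\<F>. \<exists>h\<in>D. y (- g + (k + h)) \<noteq> p h"
    using assms(2) unfolding F by (simp only: add.assoc[symmetric]) blast
  then show ?thesis using assms(2) by (auto simp: F shift_def conf_def)
qed

lemma SFT_subset_conf: "SFT n Y \<Longrightarrow> Y \<subseteq> conf n"
  by (auto simp: SFT_def)

text \<open>With \<open>E\<close> the union of the supports of the forbidden patterns, membership in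
  \<open>Y\<close> can be tested window by window, and the witness may vary with the window. This is
  what permits gluing.\<close>

lemma SFT_window:
  assumes "SFT n Y"
  obtains E where "finite E"
    "\<And>x. x \<in> conf n \<Longrightarrow> (\<And>g. \<exists>y\<in>Y. \<forall>h\<in>E. x (g + h) = y (g + h)) \<Longrightarrow> x \<in> Y"
proof -
  obtain \<F> where F: "finite \<F>" "\<And>D p. (D, p) \<in> \<F> \<Longrightarrow> finite D"
    "\<And>x. x \<in> Y \<longleftrightarrow> x \<in> conf n \<and> (\<forall>g. \<forall>(D, p)\<in>\<F>. \<exists>h\<in>D. x (g + h) \<noteq> p h)"
    using assms unfolding SFT_iff by auto
  show ?thesis
  proof (rule that)
    show "finite (\<Union>(D, p)\<in>\<F>. D)" using F(1,2) by auto
    fix x assume x: "x \<in> conf n" and ag: "\<And>g. \<exists>y\<in>Y. \<forall>h\<in>(\<Union>(D, p)\<in>\<F>. D). x (g + h) = y (g + h)"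
    have "\<exists>h\<in>D. x (g + h) \<noteq> p h" if "(D, p) \<in> \<F>" for g D p
    proof -
      obtain y where y: "y \<in> Y" "\<forall>h\<in>(\<Union>(D, p)\<in>\<F>. D). x (g + h) = y (g + h)"
        using ag[of g] by (elim bexE)
      have "\<forall>(D, p)\<in>\<F>. \<exists>h\<in>D. y (g + h) \<noteq> p h" using y(1) F(3)[of y] by simp
      from bspec[OF this that] obtain h where h: "h \<in> D" "y (g + h) \<noteq> p h" by auto
      have "h \<in> (\<Union>(D, p)\<in>\<F>. D)" using h(1) that by auto
      with y(2) have "x (g + h) = y (g + h)" by (rule bspec)
      then show ?thesis using h by (intro bexI[of _ h]) simp_all
    qed
    then show "x \<in> Y" using x F(3)[of x] by simp blast
  qed
qed

lemma SFT_cluster_point: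
  assumes "SFT n Y" "\<And>D. finite D \<Longrightarrow> \<exists>y\<in>Y. \<forall>h\<in>D. y h = x h"
  shows "x \<in> Y"
proof -
  obtain E where E: "finite E"
    "\<And>x. x \<in> conf n \<Longrightarrow> (\<And>g. \<exists>y\<in>Y. \<forall>h\<in>E. x (g + h) = y (g + h)) \<Longrightarrow> x \<in> Y"
    using SFT_window[OF assms(1)] by metis
  have "x h < n" for h
  proof -
    obtain y where "y \<in> Y" "y h = x h" using assms(2)[of "{h}"] by auto
    moreover have "y h < n" using SFT_subset_conf[OF assms(1)] \<open>y \<in> Y\<close> by (auto simp: conf_def)
    ultimately show ?thesis by simp
  qed
  moreover have "\<exists>y\<in>Y. \<forall>h\<in>E. x (g + h) = y (g + h)" for g
  proof -
    obtain y where "y \<in> Y" "\<forall>h\<in>(\<lambda>h. g + h) ` E. y h = x h"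
      using assms(2)[of "(\<lambda>h. g + h) ` E"] E(1) by blast
    then show ?thesis by (intro bexI[of _ y]) auto
  qed
  ultimately show ?thesis using E(2) by (simp add: conf_def)
qed

text \<open>Otherwise there are pairs that agree on ever longer initial segments of the enumeration
  but have different images at 0. Continuity at a cluster point rules this out; equivariance then
  carries the window from 0 to every \<open>g\<close>.\<close>

lemma Curtis_Hedlund_Lyndon:
  fixes e :: "nat \<Rightarrow> 'g::group_add" and \<phi> :: "('g \<Rightarrow> nat) \<Rightarrow> 'g \<Rightarrow> nat"
  assumes e: "range e = UNIV" and Y: "SFT n Y" and "factor_map Y X \<phi>"
  obtains E where "finite E"
    "\<And>y y' g. y \<in> Y \<Longrightarrow> y' \<in> Y \<Longrightarrow> \<forall>h\<in>E. y (g + h) = y' (g + h) \<Longrightarrow> \<phi> y g = \<phi> y' g"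
proof -
  have cont: "pd_continuous_on Y \<phi>" and equi: "\<And>g y. y \<in> Y \<Longrightarrow> \<phi> (shift g y) = shift g (\<phi> y)"
    using assms(3) by (auto simp: factor_map_def)
  have "\<exists>k. \<forall>y\<in>Y. \<forall>y'\<in>Y. (\<forall>h\<in>e ` {..<k}. y h = y' h) \<longrightarrow> \<phi> y 0 = \<phi> y' 0"
  proof (rule ccontr)
    assume "\<not> ?thesis"
    then obtain y y' where y: "\<And>k. y k \<in> Y" "\<And>k. y' k \<in> Y"
      "\<And>k h. h \<in> e ` {..<k} \<Longrightarrow> y k h = y' k h" "\<And>k. \<phi> (y k) 0 \<noteq> \<phi> (y' k) 0" by metis
    have "y k h \<in> {..<n}" for k h using y(1)[of k] SFT_subset_conf[OF Y] by (auto simp: conf_def)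
    then obtain z where z: "\<And>D k. finite D \<Longrightarrow> \<exists>r\<ge>k. \<forall>h\<in>D. y r h = z h"
      using pointwise_cluster_point[OF e, of "{..<n}" y] by blast
    have "z \<in> Y" using z y(1) by (intro SFT_cluster_point[OF Y]) blast
    then obtain D where D: "finite D" "\<And>y'. y' \<in> Y \<Longrightarrow> \<forall>h\<in>D. y' h = z h \<Longrightarrow> \<phi> y' 0 = \<phi> z 0"
      using cont unfolding pd_continuous_on_def by meson
    obtain N where N: "finite N" "D = e ` N"
      using D(1) e by (metis finite_subset_image subset_UNIV)
    obtain k where k: "\<And>i. i \<in> N \<Longrightarrow> i < k"
      using N(1) unfolding finite_nat_set_iff_bounded by auto
    obtain r where r: "r \<ge> k" "\<forall>h\<in>D. y r h = z h" using z[OF D(1)] by blast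
    \<comment> \<open>For late \<open>r\<close> the set \<open>D\<close> lies in the initial segment
      where \<open>y r\<close> and \<open>y' r\<close> agree.\<close>
    have "\<forall>h\<in>D. y' r h = z h"
    proof
      fix h assume h: "h \<in> D"
      then have "h \<in> e ` {..<r}" using N k r(1) by fastforce
      then show "y' r h = z h" using y(3) r(2) h by metis
    qed
    then have "\<phi> (y r) 0 = \<phi> (y' r) 0" using D(2) y(1,2) r(2) by metis
    then show False using y(4) by blast
  qed
  then obtain k where k: "\<And>y y'. y \<in> Y \<Longrightarrow> y' \<in> Y \<Longrightarrow> \<forall>h\<in>e ` {..<k}. y h = y' h \<Longrightarrow> \<phi> y 0 = \<phi> y' 0"
    by blast
  show ?thesis
  proof (rule that)
    fix y y' g assume y: "y \<in> Y" "y' \<in> Y" "\<forall>h\<in>e ` {..<k}. y (g + h) = y' (g + h)"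
    have "\<phi> (shift (- g) y) 0 = \<phi> (shift (- g) y') 0"
      using y by (intro k SFT_shift[OF Y]) (auto simp: shift_def)
    then show "\<phi> y g = \<phi> y' g" using y(1,2) by (simp add: equi) (simp add: shift_def)
  qed simp
qed

section \<open>Cayley graphs\<close>

definition word_ball :: "'g::group_add set \<Rightarrow> nat \<Rightarrow> 'g set" where
  "word_ball S R = {sum_list xs | xs. set xs \<subseteq> S \<and> length xs \<le> R}"

lemma finite_word_ball: "finite S \<Longrightarrow> finite (word_ball S R)"
  using finite_lists_length_le[of S R]
  by (auto simp: word_ball_def setcompr_eq_image intro: finite_imageI)

lemma finite_subset_word_ball:
  assumes "fin_sym_gen S" "finite E"
  obtains R where "E \<subseteq> word_ball S R"
proof -
  have "S \<union> uminus ` S = S" using assms(1) by (auto simp: fin_sym_gen_def symmetric_set_def)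
  then have "\<forall>g. \<exists>xs. set xs \<subseteq> S \<and> g = sum_list xs"
    using assms(1) by (auto simp: fin_sym_gen_def generates_def)
  then obtain w where w: "\<And>g. set (w g) \<subseteq> S" "\<And>g. g = sum_list (w g)" by metis
  obtain R where "\<And>g. g \<in> E \<Longrightarrow> length (w g) \<le> R"
    using finite_imageI[OF assms(2), of "\<lambda>g. length (w g)"] unfolding finite_nat_set_iff_bounded_le by auto
  then have "E \<subseteq> word_ball S R" unfolding word_ball_def using w by blast
  then show ?thesis using that by blast
qed

lemma dist_le_word_ball:
  assumes "symmetric_set S" "dist_le (cayley_adj S) u v k"
  shows "- u + v \<in> word_ball S k"
proof -
  have "walk (cayley_adj S) xs \<Longrightarrow>
      \<exists>ys. set ys \<subseteq> S \<and> length ys < length xs \<and> last xs = hd xs + sum_list ys" for xs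
  proof (induction xs)
    case Nil
    then show ?case by (simp add: walk_def)
  next
    case (Cons x xs)
    show ?case
    proof (cases xs)
      case Nil
      then show ?thesis by (intro exI[of _ "[]"]) simp
    next
      case (Cons x' xs')
      have adj: "cayley_adj S x x'" using Cons.prems Cons by (auto simp: walk_def)
      have "walk (cayley_adj S) xs"
        using Cons.prems Cons unfolding walk_def by (metis Suc_less_eq length_Cons list.distinct(1) nth_Cons_Suc)
      then obtain ys where ys: "set ys \<subseteq> S" "length ys < length xs" "last xs = x' + sum_list ys"
        using Cons.IH Cons by auto
      obtain s where "s \<in> S" "x' = x + s"
        using adj assms(1) unfolding cayley_adj_def symmetric_set_def
        by (metis add.right_neutral add.assoc right_minus)
      then show ?thesis using ys Cons by (intro exI[of _ "s # ys"]) (auto simp: add.assoc)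
    qed
  qed
  moreover obtain xs where "walk (cayley_adj S) xs" "hd xs = u" "last xs = v" "length xs \<le> Suc k"
    using assms(2) by (auto simp: dist_le_def)
  ultimately obtain ys where "set ys \<subseteq> S" "length ys < length xs" "v = u + sum_list ys" by metis
  then show ?thesis using \<open>length xs \<le> Suc k\<close>
    by (auto simp: word_ball_def add.assoc[symmetric])
qed

text \<open>For a vertex outside \<open>F\<close>, the reflexive transitive closure yields its
  component in the Cayley graph with \<open>F\<close> removed.\<close>

definition avoiding :: "'g::group_add set \<Rightarrow> 'g set \<Rightarrow> ('g \<times> 'g) set" where
  "avoiding S F = {(g, h). g \<notin> F \<and> h \<notin> F \<and> cayley_adj S g h}"

lemma sym_avoiding: "sym (avoiding S F)"
  by (auto simp: avoiding_def sym_def cayley_adj_def)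

text \<open>Follow the path spelled by \<open>xs\<close> from \<open>g\<close>. If it hits
  \<open>F\<close> at \<open>z\<close>, the remaining letters lead from \<open>z\<close> to the
  endpoint, and there are no more of them than in \<open>xs\<close>.\<close>

lemma avoiding_or_meets:
  assumes "set xs \<subseteq> S"
  shows "(g, g + sum_list xs) \<in> (avoiding S F)\<^sup>* \<or>
    (\<exists>z\<in>F. \<exists>ys. set ys \<subseteq> S \<and> length ys \<le> length xs \<and> g + sum_list xs = z + sum_list ys)"
  using assms
proof (induction xs arbitrary: g)
  case (Cons x xs)
  have eq: "g + sum_list (x # xs) = (g + x) + sum_list xs" by (simp add: add.assoc)
  consider "g \<in> F" | "g + x \<in> F" | "g \<notin> F" "g + x \<notin> F" by blast
  then show ?case
  proof cases
    case 1
    then show ?thesis using Cons.prems by blast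
  next
    case 2
    then show ?thesis using Cons.prems unfolding eq
      by (intro disjI2 bexI[of _ "g + x"] exI[of _ xs]) auto
  next
    case 3
    then have "(g, g + x) \<in> avoiding S F"
      using Cons.prems by (auto simp: avoiding_def cayley_adj_def)
    then have "(g, k) \<in> (avoiding S F)\<^sup>*" if "(g + x, k) \<in> (avoiding S F)\<^sup>*" for k
      using that by (rule converse_rtrancl_into_rtrancl)
    then show ?thesis
      using Cons.IH[of "g + x"] Cons.prems unfolding eq
      by (metis le_SucI length_Cons list.set_intros(2) subset_code(1))
  qed
qed simp

lemma walk_snoc: "walk adj xs \<Longrightarrow> adj (last xs) v \<Longrightarrow> walk adj (xs @ [v])"
proof -
  assume xs: "walk adj xs" "adj (last xs) v"
  have "adj ((xs @ [v]) ! i) ((xs @ [v]) ! Suc i)" if "Suc i < length (xs @ [v])" for i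
  proof (cases "Suc i < length xs")
    case True
    then show ?thesis using xs(1) by (auto simp: walk_def nth_append)
  next
    case False
    then have "i = length xs - 1" "Suc i = length xs" using that by auto
    then show ?thesis using xs by (simp add: nth_append walk_def last_conv_nth)
  qed
  then show ?thesis by (simp add: walk_def)
qed

lemma walk_prefix: "walk adj (xs @ ys) \<Longrightarrow> xs \<noteq> [] \<Longrightarrow> walk adj xs"
  by (fastforce simp: walk_def nth_append split: if_splits)

text \<open>A UFO restricts paths with distinct vertices, so a walk returning to a vertex is cut
  back to its visit there.\<close>

lemma avoiding_gpath:
  assumes "(u, v) \<in> (avoiding S F)\<^sup>*" "u \<notin> F"
  obtains p where "gpath (cayley_adj S) p" "hd p = u" "last p = v" "set p \<inter> F = {}"
proof -
  from assms(1) have "\<exists>p. gpath (cayley_adj S) p \<and> hd p = u \<and> last p = v \<and> set p \<inter> F = {}"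
  proof induction
    case base
    then show ?case using assms(2) by (intro exI[of _ "[u]"]) (simp add: gpath_def walk_def)
  next
    case (step v w)
    then obtain p where p: "walk (cayley_adj S) p" "distinct p" "hd p = u" "last p = v" "set p \<inter> F = {}"
      by (auto simp: gpath_def)
    show ?case
    proof (cases "w \<in> set p")
      case True
      then obtain xs ys where "p = xs @ w # ys" by (meson split_list)
      then have "walk (cayley_adj S) (xs @ [w])" "distinct (xs @ [w])" "hd (xs @ [w]) = u"
        "set (xs @ [w]) \<inter> F = {}"
        using p walk_prefix[of "cayley_adj S" "xs @ [w]" ys] by (auto simp: hd_append)
      then show ?thesis unfolding gpath_def by (metis last_snoc)
    next
      case False
      then have "walk (cayley_adj S) (p @ [w])" "distinct (p @ [w])" "set (p @ [w]) \<inter> F = {}"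
        using walk_snoc[OF p(1)] p step.hyps(2) by (auto simp: avoiding_def)
      moreover have "hd (p @ [w]) = u" using p by (auto simp: walk_def)
      ultimately show ?thesis unfolding gpath_def by (metis last_snoc)
    qed
  qed
  then show ?thesis using that by blast
qed

lemma gpath_translate:
  "gpath (cayley_adj S) p \<Longrightarrow> gpath (cayley_adj S) (map (\<lambda>h. u + h) p)"
  by (auto simp: gpath_def walk_def cayley_adj_def distinct_map add.assoc intro: inj_onI)

text \<open>Either \<open>g\<close> and \<open>g + w\<close> are joined by a path off
  \<open>F\<close> and lie on the same side, or \<open>g + w\<close> is within \<open>R\<close> of
  \<open>F\<close>, where \<open>y\<close> and \<open>y'\<close> agree. Hence each window of the
  glued configuration is a window of \<open>y\<close> or of \<open>y'\<close>.\<close>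

lemma glue_along_separator:
  assumes agree: "\<And>z w. z \<in> F \<Longrightarrow> w \<in> word_ball S R \<Longrightarrow> y (z + w) = y' (z + w)"
    and w: "w \<in> word_ball S R"
  defines "C \<equiv> {g. (0, g) \<in> (avoiding S F)\<^sup>*}"
  shows "(if g + w \<in> C then y (g + w) else y' (g + w)) = (if g \<in> C then y (g + w) else y' (g + w))"
proof -
  obtain xs where xs: "set xs \<subseteq> S" "length xs \<le> R" "w = sum_list xs" using w by (auto simp: word_ball_def)
  from avoiding_or_meets[OF xs(1), of g F] show ?thesis
  proof
    assume "(g, g + sum_list xs) \<in> (avoiding S F)\<^sup>*"
    moreover from this have "(g + sum_list xs, g) \<in> (avoiding S F)\<^sup>*"
      using sym_rtrancl[OF sym_avoiding] by (metis symE)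
    ultimately have "g + w \<in> C \<longleftrightarrow> g \<in> C"
      unfolding C_def xs(3) by (auto intro: rtrancl_trans)
    then show ?thesis by simp
  next
    assume "\<exists>z\<in>F. \<exists>ys. set ys \<subseteq> S \<and> length ys \<le> length xs \<and> g + sum_list xs = z + sum_list ys"
    then obtain z ys where "z \<in> F" "set ys \<subseteq> S" "length ys \<le> length xs" "g + w = z + sum_list ys"
      using xs(3) by blast
    then have "y (g + w) = y' (g + w)"
      using agree[of z "sum_list ys"] xs(2) by (force simp: word_ball_def)
    then show ?thesis by simp
  qed
qed

section \<open>Non-soficity\<close>

text \<open>The ratio \<open>2 * (n * card W + 1)\<close> is set by counting: at least half of
  \<open>U\<close> is matched, so the free bits outnumber \<open>n * card F * card W\<close>, while
  there are at most \<open>n ^ (card F * card W)\<close> patterns on the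
  \<open>W\<close>-neighbourhood of \<open>F\<close>. Two preimages therefore agree there although
  their images differ in a matched bit.\<close>

lemma UFO_twins:
  fixes e :: "nat \<Rightarrow> 'g::group_add" and \<phi> :: "('g \<Rightarrow> nat) \<Rightarrow> 'g \<Rightarrow> nat"
  assumes ufo: "is_UFO (cayley_adj S) (2 * (n * card W + 1)) k r U F B"
    and S: "symmetric_set S" and K: "word_ball S k \<subseteq> e ` {..<K}"
    and Y: "SFT n Y" and fm: "factor_map Y (copy_shift e) \<phi>" and W: "finite W"
  obtains y y' F' i where "y \<in> Y" "y' \<in> Y" "i < K"
    "\<And>z w. z \<in> F' \<Longrightarrow> w \<in> W \<Longrightarrow> y (z + w) = y' (z + w)"
    "src (\<phi> y) = src (\<phi> y')" "tgt (\<phi> y) = tgt (\<phi> y')"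
    "greedy e (src (\<phi> y)) (tgt (\<phi> y)) 0 i" "\<phi> y 0 \<noteq> \<phi> y' 0" "0 \<notin> F'"
    "\<And>p. gpath (cayley_adj S) p \<Longrightarrow> hd p = 0 \<Longrightarrow> last p = e i \<Longrightarrow> set p \<inter> F' \<noteq> {} \<or> r \<le> length p - 1"
proof -
  obtain f where fin: "finite U" "finite F" and disj: "U \<inter> F = {}" "U \<inter> B = {}" and "U \<noteq> {}"
    and cU: "card U \<ge> 2 * (n * card W + 1) * card F"
    and f: "bij_betw f U B" "\<And>u. u \<in> U \<Longrightarrow> dist_le (cayley_adj S) u (f u) k"
    and sep: "\<And>p. gpath (cayley_adj S) p \<Longrightarrow> hd p \<in> U \<Longrightarrow> last p \<in> B \<Longrightarrow> set p \<inter> F \<noteq> {} \<or> length p - 1 \<ge> r"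
    using ufo unfolding is_UFO_def by blast
  have bound: "\<And>y h. y \<in> Y \<Longrightarrow> y h < n" and equi: "\<And>g y. y \<in> Y \<Longrightarrow> \<phi> (shift g y) = shift g (\<phi> y)"
    and im: "\<phi> ` Y = copy_shift e"
    using SFT_subset_conf[OF Y] fm by (auto simp: factor_map_def conf_def)
  define U' where "U' = {u. \<exists>i<K. greedy e U B u i}"
  have U': "U' \<subseteq> U" "finite U'"
    using fin(1) by (auto simp: U'_def dest: greedyD intro: finite_subset[of _ U])
  have "\<exists>i<K. f u = u + e i" if "u \<in> U" for u
  proof -
    have "- u + f u \<in> e ` {..<K}" using dist_le_word_ball[OF S f(2)[OF that]] K by blast
    then obtain i where "i < K" "- u + f u = e i" by auto
    then show ?thesis by (metis add_minus_cancel)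
  qed
  then have "card U \<le> 2 * card U'"
    unfolding U'_def using card_greedy_half[OF fin(1) f(1)] by blast
  moreover have "card U > 0" using fin(1) \<open>U \<noteq> {}\<close> by (simp add: card_gt_0_iff)
  \<comment> \<open>If \<open>F\<close> is empty, strictness comes from \<open>U\<close> being
    nonempty; otherwise from the summand 1 in the ratio.\<close>
  ultimately have cU': "n * (card F * card W) < card U'"
    using cU by (cases "card F = 0") (auto simp: algebra_simps)

  have "\<forall>p. \<exists>y. y \<in> Y \<and> \<phi> y = copy_config e U B p"
    using copy_config_in_copy_shift[OF disj(2)] im by (metis imageE)
  then obtain yy where yy: "\<And>p. yy p \<in> Y" "\<And>p. \<phi> (yy p) = copy_config e U B p" by metis
  define FW where "FW = (\<lambda>(z, w). z + w) ` (F \<times> W)"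
  have FW: "finite FW" "card FW \<le> card F * card W"
    unfolding FW_def using fin(2) W card_image_le[of "F \<times> W" "\<lambda>(z, w). z + w"]
    by (auto simp: card_cartesian_product)
  let ?G = "\<lambda>p. restrict (yy p) FW"
  have "\<not> inj_on ?G (Pow U')"
  proof
    assume "inj_on ?G (Pow U')"
    moreover have "?G ` Pow U' \<subseteq> PiE FW (\<lambda>_. {..<n})"
      using bound[OF yy(1)] by auto
    ultimately have "card (Pow U') \<le> card (PiE FW (\<lambda>_. {..<n}))"
      using FW(1) by (intro card_inj_on_le finite_PiE) auto
    also have "\<dots> = n ^ card FW" using FW(1) by (simp add: card_PiE)
    \<comment> \<open>The crude bound \<open>n \<le> 2 ^ n\<close> reduces the comparison to
      exponents of 2.\<close>
    also have "\<dots> \<le> (2 ^ n) ^ card FW" by (intro power_mono) (auto intro: less_imp_le)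
    also have "\<dots> = 2 ^ (n * card FW)" by (simp add: power_mult)
    also have "\<dots> \<le> 2 ^ (n * (card F * card W))" using FW(2) by (intro power_increasing) auto
    also have "\<dots> < 2 ^ card U'" using cU' by simp
    also have "\<dots> = card (Pow U')" using U'(2) by (simp add: card_Pow)
    finally show False by simp
  qed
  then obtain p p' where p: "p \<subseteq> U'" "p' \<subseteq> U'" "?G p = ?G p'" "p \<noteq> p'"
    by (auto simp: inj_on_def)
  then obtain u where u: "u \<in> U'" "u \<in> p \<longleftrightarrow> u \<notin> p'" by blast
  then obtain i where i: "i < K" "greedy e U B u i" by (auto simp: U'_def)
  have uU: "u \<in> U" "u \<notin> F" using u(1) U'(1) disj(1) by auto
  have img: "\<phi> (shift (- u) (yy q)) = (\<lambda>h. copy_config e U B q (u + h))" for q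
    using equi[OF yy(1)] by (simp add: yy(2)) (simp add: shift_def)
  have src: "src (\<phi> (shift (- u) (yy q))) = {h. u + h \<in> U}" for q
    using src_copy_config[of e U B q] unfolding img by (auto simp: src_def)
  have tgt: "tgt (\<phi> (shift (- u) (yy q))) = {h. u + h \<in> B}" for q
    using tgt_copy_config[OF disj(2), of e q] unfolding img by (auto simp: tgt_def)
  \<comment> \<open>Both preimages are translated so that \<open>u\<close>, where \<open>p\<close>
    and \<open>p'\<close> differ, sits at the origin; \<open>F'\<close> is the translate of
    \<open>F\<close>.\<close>
  show ?thesis
  proof (rule that[of "shift (- u) (yy p)" "shift (- u) (yy p')" i "{z. u + z \<in> F}"])
    show "shift (- u) (yy p) \<in> Y" "shift (- u) (yy p') \<in> Y" by (intro SFT_shift[OF Y] yy(1))+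
    show "i < K" by (fact i(1))
    show "0 \<notin> {z. u + z \<in> F}" using uU by simp
    show "greedy e (src (\<phi> (shift (- u) (yy p)))) (tgt (\<phi> (shift (- u) (yy p)))) 0 i"
      unfolding src tgt using greedy_translate[of e U B u 0 i] i(2) by simp
    show "\<phi> (shift (- u) (yy p)) 0 \<noteq> \<phi> (shift (- u) (yy p')) 0"
      using uU(1) u(2) by (auto simp: img copy_config_def)
    fix z w assume zw: "z \<in> {z. u + z \<in> F}" "w \<in> W"
    then have "u + z + w \<in> FW" by (force simp: FW_def)
    then have "yy p (u + z + w) = yy p' (u + z + w)" using p(3) by (metis restrict_apply)
    then show "shift (- u) (yy p) (z + w) = shift (- u) (yy p') (z + w)"
      by (simp add: shift_def add.assoc)
  next
    fix q assume q: "gpath (cayley_adj S) q" "hd q = 0" "last q = e i"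
    then have ne: "q \<noteq> []" by (auto simp: gpath_def walk_def)
    have "set (map (\<lambda>h. u + h) q) \<inter> F \<noteq> {} \<or> length (map (\<lambda>h. u + h) q) - 1 \<ge> r"
      using greedyD(2)[OF i(2)] ne q uU(1)
      by (intro sep gpath_translate) (auto simp: hd_map last_map)
    then show "set q \<inter> {z. u + z \<in> F} \<noteq> {} \<or> r \<le> length q - 1" by auto
  qed (simp_all add: src tgt)
qed

theorem copy_shift_not_sofic:
  fixes e :: "nat \<Rightarrow> 'g::group_add"
  assumes e: "range e = UNIV" and "extraterrestrial_group TYPE('g)"
    and Y: "SFT n Y"
  shows "\<not> factor_map Y (copy_shift e) \<phi>"
proof
  assume fm: "factor_map Y (copy_shift e) \<phi>"
  obtain S :: "'g set" where S: "fin_sym_gen S" "extraterrestrial_graph (cayley_adj S)"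
    using assms(2) by (auto simp: extraterrestrial_group_def)
  obtain E1 where E1: "finite E1"
    "\<And>x. x \<in> conf n \<Longrightarrow> (\<And>g. \<exists>y\<in>Y. \<forall>h\<in>E1. x (g + h) = y (g + h)) \<Longrightarrow> x \<in> Y"
    using SFT_window[OF Y] by blast
  obtain E2 where E2: "finite E2"
    "\<And>y y' g. y \<in> Y \<Longrightarrow> y' \<in> Y \<Longrightarrow> \<forall>h\<in>E2. y (g + h) = y' (g + h) \<Longrightarrow> \<phi> y g = \<phi> y' g"
    using Curtis_Hedlund_Lyndon[OF e Y fm] by blast
  \<comment> \<open>A common radius for the window of \<open>Y\<close> and the local rule of
    \<open>\<phi>\<close>.\<close>
  obtain R where R: "E1 \<union> E2 \<subseteq> word_ball S R"
    using finite_subset_word_ball[OF S(1)] E1(1) E2(1) by (metis finite_UnI)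
  define W where "W = word_ball S R"
  have sym: "symmetric_set S" "finite S" using S(1) by (auto simp: fin_sym_gen_def)
  have W: "finite W" unfolding W_def by (rule finite_word_ball[OF sym(2)])
  have window: "x \<in> Y" if "x \<in> conf n" "\<And>g. \<exists>y\<in>Y. \<forall>h\<in>W. x (g + h) = y (g + h)" for x
    using that R unfolding W_def by (intro E1(2)) blast+
  have \<phi>_local: "\<phi> y g = \<phi> y' g" if "y \<in> Y" "y' \<in> Y" "\<forall>h\<in>W. y (g + h) = y' (g + h)" for y y' g
    using that R unfolding W_def by (intro E2(2)) blast+
  \<comment> \<open>Here \<open>k\<close> is fixed before \<open>r\<close>, so the bound
    \<open>K\<close> on the stage of the match is uniform in \<open>r\<close>.\<close>
  obtain k where k: "\<And>r. \<exists>U F B. is_UFO (cayley_adj S) (2 * (n * card W + 1)) k r U F B"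
    using S(2) unfolding extraterrestrial_graph_def by blast
  obtain N where N: "finite N" "word_ball S k = e ` N"
    using finite_word_ball[OF sym(2), of k] e by (metis finite_subset_image subset_UNIV)
  obtain K where "N \<subseteq> {..<K}" using N(1) finite_nat_iff_bounded by blast
  then have K: "word_ball S k \<subseteq> e ` {..<K}" using N(2) by blast

  have "\<exists>y y' F i. y \<in> Y \<and> y' \<in> Y \<and> i < K \<and>
    (\<forall>z\<in>F. \<forall>w\<in>W. y (z + w) = y' (z + w)) \<and>
    src (\<phi> y) = src (\<phi> y') \<and> tgt (\<phi> y) = tgt (\<phi> y') \<and>
    greedy e (src (\<phi> y)) (tgt (\<phi> y)) 0 i \<and> \<phi> y 0 \<noteq> \<phi> y' 0 \<and> 0 \<notin> F \<and>
    (\<forall>p. gpath (cayley_adj S) p \<longrightarrow> hd p = 0 \<longrightarrow> last p = e i \<longrightarrow> set p \<inter> F \<noteq> {} \<or> r \<le> length p - 1)" for r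
  proof -
    obtain U F B where "is_UFO (cayley_adj S) (2 * (n * card W + 1)) k r U F B" using k by blast
    from UFO_twins[OF this sym(1) K Y fm W] show ?thesis by metis
  qed
  then obtain y y' F i where yr: "\<And>r. y r \<in> Y" "\<And>r. y' r \<in> Y" "\<And>r. i r < K"
    "\<And>r z w. z \<in> F r \<Longrightarrow> w \<in> W \<Longrightarrow> y r (z + w) = y' r (z + w)"
    "\<And>r. src (\<phi> (y r)) = src (\<phi> (y' r))" "\<And>r. tgt (\<phi> (y r)) = tgt (\<phi> (y' r))"
    "\<And>r. greedy e (src (\<phi> (y r))) (tgt (\<phi> (y r))) 0 (i r)" "\<And>r. \<phi> (y r) 0 \<noteq> \<phi> (y' r) 0"
    "\<And>r. 0 \<notin> F r"
    "\<And>r p. gpath (cayley_adj S) p \<Longrightarrow> hd p = 0 \<Longrightarrow> last p = e (i r) \<Longrightarrow> set p \<inter> F r \<noteq> {} \<or> r \<le> length p - 1"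
    by metis
  \<comment> \<open>Packing the two preimages, the separator and the stage into one configuration
    over a finite alphabet makes a single cluster point serve for all four.\<close>
  define z where "z r h = (y r h, y' r h, h \<in> F r, i r)" for r h
  have "finite ({..<n} \<times> {..<n} \<times> (UNIV :: bool set) \<times> {..<K})" by simp
  moreover have "z r h \<in> {..<n} \<times> {..<n} \<times> UNIV \<times> {..<K}" for r h
    using yr(1-3)[of r] SFT_subset_conf[OF Y] by (auto simp: z_def conf_def)
  ultimately obtain z' where z': "\<And>D r0. finite D \<Longrightarrow> \<exists>r\<ge>r0. \<forall>h\<in>D. z r h = z' h"
    using pointwise_cluster_point[OF e, of "{..<n} \<times> {..<n} \<times> UNIV \<times> {..<K}" z] by blast
  define yl yl' Fl il where "yl = (\<lambda>h. fst (z' h))" and "yl' = (\<lambda>h. fst (snd (z' h)))"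
    and "Fl = {h. fst (snd (snd (z' h)))}" and "il = snd (snd (snd (z' 0)))"
  have lim: "\<exists>r\<ge>r0. i r = il \<and> (\<forall>h\<in>D. y r h = yl h \<and> y' r h = yl' h \<and> (h \<in> F r \<longleftrightarrow> h \<in> Fl))"
    if fin: "finite D" for D r0
  proof -
    obtain r where r: "r \<ge> r0" "\<forall>h\<in>insert 0 D. z r h = z' h" using z'[of "insert 0 D"] fin by auto
    have "z r 0 = z' 0" using r(2) by simp
    then have "i r = il" by (metis il_def z_def snd_conv)
    moreover have "y r h = yl h \<and> y' r h = yl' h \<and> (h \<in> F r \<longleftrightarrow> h \<in> Fl)" if "h \<in> D" for h
    proof -
      have "z' h = (y r h, y' r h, h \<in> F r, i r)" using r(2) that by (simp add: z_def)
      then show ?thesis by (simp add: yl_def yl'_def Fl_def)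
    qed
    ultimately show ?thesis using r(1) by blast
  qed
  have yl: "yl \<in> Y" "yl' \<in> Y"
    using lim yr(1,2) by (intro SFT_cluster_point[OF Y]; metis)+
  have sep_agree: "yl (z + w) = yl' (z + w)" if "z \<in> Fl" "w \<in> word_ball S R" for z w
    using lim[of "{z, z + w}" 0] yr(4)[of z _ w] that by (auto simp: W_def)
  define C where "C = {g. (0, g) \<in> (avoiding S Fl)\<^sup>*}"
  define x where "x g = (if g \<in> C then yl g else yl' g)" for g
  have glue: "x (g + w) = (if g \<in> C then yl (g + w) else yl' (g + w))" if "w \<in> W" for g w
    unfolding x_def C_def
    using glue_along_separator[of Fl S R yl yl' w g] sep_agree that by (simp add: W_def)
  have xY: "x \<in> Y"
  proof (rule window)
    show "x \<in> conf n" using yl SFT_subset_conf[OF Y] by (auto simp: conf_def x_def)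
    show "\<exists>y\<in>Y. \<forall>h\<in>W. x (g + h) = y (g + h)" for g
      using yl glue[of _ g] by (cases "g \<in> C") auto
  qed
  have \<phi>x: "\<phi> x g = (if g \<in> C then \<phi> yl g else \<phi> yl' g)" for g
    using yl xY glue[of _ g] by (auto intro!: \<phi>_local)
  have \<phi>lim: "\<exists>r\<ge>r0. i r = il \<and> (\<forall>h\<in>D. \<phi> (y r) h = \<phi> yl h \<and> \<phi> (y' r) h = \<phi> yl' h)"
    if fin: "finite D" for D r0
  proof -
    obtain r where r: "r \<ge> r0" "i r = il"
      "\<forall>h\<in>(\<lambda>(g, w). g + w) ` (D \<times> W). y r h = yl h \<and> y' r h = yl' h"
      using lim[of "(\<lambda>(g, w). g + w) ` (D \<times> W)" r0] fin W by blast
    have "\<phi> (y r) h = \<phi> yl h \<and> \<phi> (y' r) h = \<phi> yl' h" if "h \<in> D" for h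
      using r(3) that yl yr(1,2) by (intro conjI \<phi>_local) force+
    then show ?thesis using r(1,2) by blast
  qed
  have "e il \<notin> C"
  proof
    assume "e il \<in> C"
    moreover have "0 \<notin> Fl" using lim[of "{0}" 0] yr(9) by auto
    ultimately obtain p where p: "gpath (cayley_adj S) p" "hd p = 0" "last p = e il" "set p \<inter> Fl = {}"
      unfolding C_def using avoiding_gpath by blast
    \<comment> \<open>A path off \<open>Fl\<close> from 0 to \<open>e il\<close> has a fixed length.
      For some \<open>r\<close> beyond that length it also avoids \<open>F r\<close>, against the
      UFO property.\<close>
    obtain r where r: "r \<ge> length p" "i r = il" "\<forall>h\<in>set p. h \<in> F r \<longleftrightarrow> h \<in> Fl"
      using lim[of "set p" "length p"] by auto
    have "p \<noteq> []" using p(1) by (auto simp: gpath_def walk_def)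
    then have "\<not> r \<le> length p - 1" using r(1) by (cases p) auto
    then show False using yr(10)[OF p(1,2), of r] p(3,4) r(2,3) by auto
  qed
  obtain D where D: "finite D"
    "\<And>A B A' B' g. \<forall>h\<in>D. (g + h \<in> A \<longleftrightarrow> g + h \<in> A') \<and> (g + h \<in> B \<longleftrightarrow> g + h \<in> B') \<Longrightarrow>
       greedy e A B g il = greedy e A' B' g il"
    using greedy_local[of e il] by metis
  obtain r where r: "i r = il"
    "\<And>h. h \<in> insert 0 (insert (e il) D) \<Longrightarrow> \<phi> (y r) h = \<phi> yl h \<and> \<phi> (y' r) h = \<phi> yl' h"
    using \<phi>lim[of "insert 0 (insert (e il) D)" 0] D(1) by auto
  \<comment> \<open>Both images have the same sources and targets, so it does not matter on which
    side of the separator \<open>h\<close> lies. The origin is therefore still matched at stage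
    \<open>il\<close> in \<open>\<phi> x\<close>.\<close>
  have type: "h \<in> src (\<phi> x) \<longleftrightarrow> h \<in> src (\<phi> (y r))" "h \<in> tgt (\<phi> x) \<longleftrightarrow> h \<in> tgt (\<phi> (y r))" if "h \<in> D" for h
  proof -
    have "\<phi> x h = (if h \<in> C then \<phi> (y r) else \<phi> (y' r)) h" using r(2)[of h] that by (simp add: \<phi>x)
    then have "h \<in> src (\<phi> x) \<longleftrightarrow> h \<in> src (if h \<in> C then \<phi> (y r) else \<phi> (y' r))"
      "h \<in> tgt (\<phi> x) \<longleftrightarrow> h \<in> tgt (if h \<in> C then \<phi> (y r) else \<phi> (y' r))"
      by (simp_all add: src_def tgt_def)
    then show "h \<in> src (\<phi> x) \<longleftrightarrow> h \<in> src (\<phi> (y r))" "h \<in> tgt (\<phi> x) \<longleftrightarrow> h \<in> tgt (\<phi> (y r))"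
      using yr(5,6)[of r] by simp_all
  qed
  have "greedy e (src (\<phi> x)) (tgt (\<phi> x)) 0 il = greedy e (src (\<phi> (y r))) (tgt (\<phi> (y r))) 0 il"
    using type by (intro D(2)) simp
  then have "greedy e (src (\<phi> x)) (tgt (\<phi> x)) 0 il" using yr(7)[of r] r(1) by simp
  moreover have inX: "\<phi> w \<in> copy_shift e" if "w \<in> Y" for w using fm that by (auto simp: factor_map_def)
  ultimately have "\<phi> x (0 + e il) = \<phi> x 0 + 2" using inX[OF xY] unfolding copy_shift_def by blast
  \<comment> \<open>The source symbol is read from \<open>y r\<close>, the target symbol from
    \<open>y' r\<close>. Since \<open>y' r\<close> obeys the rule as well, the two source symbols
    would coincide.\<close>
  then have "\<phi> (y' r) (e il) = \<phi> (y r) 0 + 2"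
    using r(2) \<open>e il \<notin> C\<close> by (simp add: \<phi>x C_def)
  moreover have "greedy e (src (\<phi> (y' r))) (tgt (\<phi> (y' r))) 0 il" using yr(5-7)[of r] r(1) by simp
  then have "\<phi> (y' r) (0 + e il) = \<phi> (y' r) 0 + 2"
    using inX[OF yr(2)[of r]] unfolding copy_shift_def by blast
  ultimately show False using yr(8)[of r] by simp
qed

section \<open>Recursive functions\<close>

inductive_cases reval_elims:
  "reval Zf xs z" "reval Sf xs z" "reval (Idf i) xs z" "reval (Cnf f gs) xs z"
  "reval (Prf f g) (0 # xs) z" "reval (Prf f g) (Suc k # xs) z" "reval (Mnf f) xs z"

text \<open>For minimisation, the smaller of two results would be a zero of \<open>f\<close> at a
  place where the other run demands a positive value. Determinism is needed to read the outcome of a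
  test off a halting search in \<open>re_set_ex\<close>.\<close>

lemma reval_deterministic: "reval f xs y \<Longrightarrow> reval f xs z \<Longrightarrow> y = z"
proof (induction arbitrary: z rule: reval.induct)
  case (zero xs)
  then show ?case by (rule reval_elims(1)) simp
next
  case (succ x)
  from succ.prems show ?case by (rule reval_elims(2)) simp
next
  case (proj i xs)
  from proj.prems show ?case by (rule reval_elims(3)) simp
next
  case (comp xs gs ys f y)
  from comp.prems obtain ys' where ys': "list_all2 (\<lambda>g y. reval g xs y) gs ys'" "reval f ys' z"
    by (rule reval_elims(4))
  have "ys = ys'"
  proof (rule nth_equalityI)
    show "length ys = length ys'"
      using comp.IH(1) ys'(1) by (simp add: list_all2_conv_all_nth)
    fix i assume "i < length ys"
    then show "ys ! i = ys' ! i"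
      using comp.IH(1) ys'(1) by (simp add: list_all2_conv_all_nth)
  qed
  then show ?case using comp.IH(2) ys'(2) by simp
next
  case (pr0 f xs y g)
  from pr0.prems show ?case by (rule reval_elims(5)) (rule pr0.IH)
next
  case (prS f g k xs r y)
  from prS.prems obtain r' where "reval (Prf f g) (k # xs) r'" "reval g (k # r' # xs) z"
    by (rule reval_elims(6))
  then show ?case using prS.IH by simp
next
  case (mn f k xs)
  from mn.prems have z: "reval f (z # xs) 0" "\<forall>i<z. \<exists>y. reval f (i # xs) y \<and> 0 < y"
    by (rule reval_elims(7), simp)+
  show ?case
  proof (rule linorder_cases[of k z])
    assume "k < z"
    then obtain y where "reval f (k # xs) y" "0 < y" using z(2) by blast
    then show ?thesis using mn.IH(1) by force
  next
    assume "z < k"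
    then obtain y where "\<And>w. reval f (z # xs) w \<Longrightarrow> y = w" "0 < y" using mn.IH(2) by blast
    then show ?thesis using z(1) by force
  qed
qed

lemma reval_comp1: "reval g xs a \<Longrightarrow> reval f [a] z \<Longrightarrow> reval (Cnf f [g]) xs z"
  by (rule reval.comp[of _ _ "[a]"]) auto

lemma reval_comp2: "reval g xs a \<Longrightarrow> reval h xs b \<Longrightarrow> reval f [a, b] z \<Longrightarrow> reval (Cnf f [g, h]) xs z"
  by (rule reval.comp[of _ _ "[a, b]"]) auto

lemma reval_proj0: "reval (Idf 0) (x # xs) x"
  using reval.proj[of 0 "x # xs"] by simp

lemma reval_proj1: "reval (Idf 1) (x # y # xs) y"
  using reval.proj[of 1 "x # y # xs"] by simp

lemma reval_prim_rec:
  assumes "reval f xs (h 0)" "\<And>k. reval g (k # h k # xs) (h (Suc k))"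
  shows "reval (Prf f g) (n # xs) (h n)"
  by (induction n) (auto intro: assms reval.pr0 reval.prS)

section \<open>Closure properties of total recursive functions\<close>

definition total_rec :: "(nat \<Rightarrow> nat) \<Rightarrow> bool" where
  "total_rec F \<longleftrightarrow> (\<exists>f. \<forall>x. reval f [x] (F x))"

definition total_rec2 :: "(nat \<Rightarrow> nat \<Rightarrow> nat) \<Rightarrow> bool" where
  "total_rec2 F \<longleftrightarrow> (\<exists>f. \<forall>x y. reval f [x, y] (F x y))"

lemma total_rec_comp: "total_rec H \<Longrightarrow> total_rec F \<Longrightarrow> total_rec (\<lambda>x. H (F x))"
  unfolding total_rec_def by (meson reval_comp1)

lemma total_rec_comp2:
  "total_rec2 H \<Longrightarrow> total_rec F \<Longrightarrow> total_rec G \<Longrightarrow> total_rec (\<lambda>x. H (F x) (G x))"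
  unfolding total_rec_def total_rec2_def by (meson reval_comp2)

lemma total_rec2_comp1: "total_rec H \<Longrightarrow> total_rec2 F \<Longrightarrow> total_rec2 (\<lambda>x y. H (F x y))"
  unfolding total_rec_def total_rec2_def by (meson reval_comp1)

lemma total_rec2_comp2:
  "total_rec2 H \<Longrightarrow> total_rec2 F \<Longrightarrow> total_rec2 G \<Longrightarrow> total_rec2 (\<lambda>x y. H (F x y) (G x y))"
  unfolding total_rec2_def by (meson reval_comp2)

lemma total_rec2_proj: "total_rec2 (\<lambda>x y. x)" "total_rec2 (\<lambda>x y. y)"
  unfolding total_rec2_def using reval_proj0 reval_proj1 by blast+

lemma total_rec_id: "total_rec (\<lambda>x. x)"
  unfolding total_rec_def using reval_proj0 by blast

lemma total_rec_Suc: "total_rec F \<Longrightarrow> total_rec (\<lambda>x. Suc (F x))"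
  unfolding total_rec_def by (meson reval_comp1 reval.succ)

lemma total_rec_const: "total_rec (\<lambda>x. c)"
proof (induction c)
  case 0
  then show ?case unfolding total_rec_def using reval.zero by blast
qed (rule total_rec_Suc)

lemma total_rec2_prim_rec:
  assumes "total_rec F" "total_rec2 G" "\<And>x. H 0 x = F x" "\<And>n x. H (Suc n) x = G n (H n x)"
  shows "total_rec2 H"
proof -
  obtain f where f: "\<And>x. reval f [x] (F x)" using assms(1) by (auto simp: total_rec_def)
  obtain g where g: "\<And>x y. reval g [x, y] (G x y)" using assms(2) by (auto simp: total_rec2_def)
  have "reval (Prf f (Cnf g [Idf 0, Idf 1])) [n, x] (H n x)" for n x
    using reval_prim_rec[of f "[x]" "\<lambda>n. H n x" "Cnf g [Idf 0, Idf 1]" n] assms(3,4) f g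
    by (metis reval_comp2 reval_proj0 reval_proj1)
  then show ?thesis unfolding total_rec2_def by blast
qed

lemma total_rec_prim_rec:
  assumes "total_rec2 G" "H 0 = 0" "\<And>n. H (Suc n) = G n (H n)"
  shows "total_rec H"
proof -
  have "total_rec2 (\<lambda>n _. H n)"
    by (rule total_rec2_prim_rec[OF total_rec_const assms(1)]) (use assms(2,3) in auto)
  from total_rec_comp2[OF this total_rec_id total_rec_id] show ?thesis .
qed

lemma total_rec2_add: "total_rec2 (+)"
  by (rule total_rec2_prim_rec[OF total_rec_id
        total_rec2_comp1[OF total_rec_Suc[OF total_rec_id] total_rec2_proj(2)]]) auto

lemma total_rec_pred: "total_rec (\<lambda>x. x - 1)"
  by (rule total_rec_prim_rec[where G = "\<lambda>n _. n"]) (auto intro: total_rec2_proj)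

text \<open>The subtrahend comes first because the recursion runs on the first argument.\<close>

lemma total_rec2_diff: "total_rec2 (\<lambda>n x. x - n)"
  by (rule total_rec2_prim_rec[OF total_rec_id
        total_rec2_comp1[OF total_rec_pred total_rec2_proj(2)]]) auto

lemma total_rec_triangle: "total_rec triangle"
  by (rule total_rec_prim_rec[where G = "\<lambda>n r. r + Suc n"])
    (auto intro!: total_rec2_comp2[OF total_rec2_add] total_rec2_comp1[where H = Suc] total_rec2_proj
      total_rec_Suc total_rec_id)

lemma total_rec2_prod_encode: "total_rec2 (\<lambda>x y. prod_encode (x, y))"
  unfolding prod_encode_def case_prod_conv
  by (intro total_rec2_comp2[OF total_rec2_add] total_rec2_comp1[OF total_rec_triangle] total_rec2_proj
      total_rec2_add)

lemma total_rec2_funpow: "total_rec H \<Longrightarrow> total_rec2 (\<lambda>n s. (H ^^ n) s)"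
  by (rule total_rec2_prim_rec[OF total_rec_id total_rec2_comp1[OF _ total_rec2_proj(2)]]) auto

lemma total_rec_add: "total_rec F \<Longrightarrow> total_rec G \<Longrightarrow> total_rec (\<lambda>x. F x + G x)"
  by (rule total_rec_comp2[OF total_rec2_add])

lemma total_rec_diff: "total_rec F \<Longrightarrow> total_rec G \<Longrightarrow> total_rec (\<lambda>x. F x - G x)"
  by (rule total_rec_comp2[OF total_rec2_diff])

lemma total_rec_pair: "total_rec F \<Longrightarrow> total_rec G \<Longrightarrow> total_rec (\<lambda>x. prod_encode (F x, G x))"
  by (rule total_rec_comp2[OF total_rec2_prod_encode])

lemma total_rec_Least:
  assumes "total_rec2 F" "\<And>x. \<exists>k. F k x = 0"
  shows "total_rec (\<lambda>x. LEAST k. F k x = 0)"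
proof -
  obtain f where f: "\<And>k x. reval f [k, x] (F k x)" using assms(1) by (auto simp: total_rec2_def)
  have "reval (Mnf f) [x] (LEAST k. F k x = 0)" for x
  proof (rule reval.mn)
    show "reval f [LEAST k. F k x = 0, x] 0" using LeastI_ex[OF assms(2)[of x]] f by metis
    show "\<forall>i<LEAST k. F k x = 0. \<exists>y. reval f [i, x] y \<and> 0 < y"
      using not_less_Least f by blast
  qed
  then show ?thesis unfolding total_rec_def by blast
qed

text \<open>The diagonal \<open>m + n\<close> of the pair coded by \<open>x\<close> is the least \<open>k\<close> with \<open>x < triangle (Suc k)\<close>.\<close>

lemma total_rec_prod_decode:
  "total_rec (\<lambda>x. fst (prod_decode x))" "total_rec (\<lambda>x. snd (prod_decode x))"
proof -
  define lev where "lev x = (LEAST k. Suc x - triangle (Suc k) = 0)" for x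
  have lev: "lev (prod_encode (m, n)) = m + n" for m n
    unfolding lev_def
  proof (rule Least_equality)
    show "Suc (prod_encode (m, n)) - triangle (Suc (m + n)) = 0" by (simp add: prod_encode_def)
    fix k assume k: "Suc (prod_encode (m, n)) - triangle (Suc k) = 0"
    show "m + n \<le> k"
    proof (rule ccontr)
      assume "\<not> m + n \<le> k"
      moreover have "mono triangle" by (simp add: mono_iff_le_Suc)
      ultimately have "triangle (Suc k) \<le> triangle (m + n)" using monoD[of triangle "Suc k" "m + n"] by simp
      with k show False by (simp add: prod_encode_def)
    qed
  qed
  have "total_rec lev"
    unfolding lev_def
  proof (rule total_rec_Least)
    show "total_rec2 (\<lambda>k x. Suc x - triangle (Suc k))"
      by (intro total_rec2_comp2[OF total_rec2_diff] total_rec2_comp1[OF total_rec_triangle]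
          total_rec2_comp1[where H = Suc] total_rec_Suc total_rec_id total_rec2_proj)
    show "\<exists>k. Suc x - triangle (Suc k) = 0" for x
      by (rule exI[of _ x]) simp
  qed
  moreover have "fst (prod_decode x) = x - triangle (lev x)"
    and "snd (prod_decode x) = lev x - (x - triangle (lev x))" for x
  proof -
    obtain m n where x: "prod_decode x = (m, n)" by fastforce
    then have eq: "x = prod_encode (m, n)" by (metis prod_decode_inverse)
    have "lev x = m + n" unfolding eq by (rule lev)
    moreover have "x = triangle (m + n) + m" by (simp add: eq prod_encode_def)
    ultimately
    show "fst (prod_decode x) = x - triangle (lev x)" "snd (prod_decode x) = lev x - (x - triangle (lev x))"
      using x by simp_all
  qed
  ultimately show "total_rec (\<lambda>x. fst (prod_decode x))" "total_rec (\<lambda>x. snd (prod_decode x))"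
    by (simp_all only:) (intro total_rec_diff total_rec_comp[OF total_rec_triangle] total_rec_id; assumption)+
qed

lemmas total_rec_fst = total_rec_comp[OF total_rec_prod_decode(1)]
lemmas total_rec_snd = total_rec_comp[OF total_rec_prod_decode(2)]

named_theorems rec_intros

lemmas [rec_intros] = total_rec_id total_rec_const total_rec_Suc total_rec_add total_rec_diff
  total_rec_pair total_rec_fst total_rec_snd

text \<open>The iterated map depends on \<open>x\<close>, so the state is the pair of
  \<open>x\<close> and the current value. All later loops are built from this.\<close>

lemma total_rec_funpow [rec_intros]:
  assumes "total_rec (\<lambda>z. H (fst (prod_decode z)) (snd (prod_decode z)))" "total_rec F" "total_rec G"
  shows "total_rec (\<lambda>x. (H x ^^ F x) (G x))"
proof -
  define J where "J z = prod_encode (fst (prod_decode z), H (fst (prod_decode z)) (snd (prod_decode z)))" for z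
  have J: "(J ^^ n) (prod_encode (x, s)) = prod_encode (x, (H x ^^ n) s)" for n x s
    by (induction n) (simp_all add: J_def)
  have "total_rec J" unfolding J_def by (intro total_rec_pair total_rec_prod_decode(1) assms(1))
  then have "total_rec (\<lambda>x. snd (prod_decode ((J ^^ F x) (prod_encode (x, G x)))))"
    by (intro total_rec_snd total_rec_comp2[OF total_rec2_funpow] assms rec_intros)
  then show ?thesis by (simp add: J)
qed

section \<open>Decidable predicates\<close>

definition decidable :: "(nat \<Rightarrow> bool) \<Rightarrow> bool" where
  "decidable P \<longleftrightarrow> total_rec (\<lambda>x. of_bool (P x))"

lemma decidable_comp: "decidable P \<Longrightarrow> total_rec F \<Longrightarrow> decidable (\<lambda>x. P (F x))"
  unfolding decidable_def by (rule total_rec_comp)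

lemma decidable_not [rec_intros]:
  assumes "decidable P"
  shows "decidable (\<lambda>x. \<not> P x)"
proof -
  have "of_bool (\<not> P x) = 1 - (of_bool (P x) :: nat)" for x
    by simp
  then show ?thesis using assms unfolding decidable_def by (simp only:) (intro rec_intros)
qed

lemma decidable_conj [rec_intros]:
  assumes "decidable P" "decidable Q"
  shows "decidable (\<lambda>x. P x \<and> Q x)"
proof -
  have "of_bool (P x \<and> Q x) = 1 - ((1 - of_bool (P x)) + (1 - of_bool (Q x)) :: nat)" for x
    by simp
  then show ?thesis using assms unfolding decidable_def by (simp only:) (intro rec_intros)
qed

lemma decidable_disj [rec_intros]: "decidable P \<Longrightarrow> decidable Q \<Longrightarrow> decidable (\<lambda>x. P x \<or> Q x)"
  using decidable_not[OF decidable_conj[OF decidable_not decidable_not]] by simp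

lemma decidable_imp [rec_intros]: "decidable P \<Longrightarrow> decidable Q \<Longrightarrow> decidable (\<lambda>x. P x \<longrightarrow> Q x)"
  unfolding imp_conv_disj by (intro rec_intros)

lemma decidable_eq [rec_intros]:
  assumes "total_rec F" "total_rec G"
  shows "decidable (\<lambda>x. F x = G x)"
proof -
  have "of_bool (F x = G x) = 1 - ((F x - G x) + (G x - F x))" for x
    by auto
  then show ?thesis using assms unfolding decidable_def by (simp only:) (intro rec_intros)
qed

lemma total_rec_if [rec_intros]:
  assumes "decidable P" "total_rec F" "total_rec G"
  shows "total_rec (\<lambda>x. if P x then F x else G x)"
proof -
  \<comment> \<open>A conditional is a constant map iterated once or not at all.\<close>
  have "total_rec (\<lambda>x. ((\<lambda>_. F x) ^^ of_bool (P x)) (G x))"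
    using assms unfolding decidable_def by (intro rec_intros total_rec_comp[OF assms(2)])
  then show ?thesis by (rule back_subst[of total_rec]) auto
qed

text \<open>The state of the loop is a counter together with the truth value found so far.\<close>

lemma decidable_all_less [rec_intros]:
  assumes "decidable (\<lambda>z. P (fst (prod_decode z)) (snd (prod_decode z)))" "total_rec F"
  shows "decidable (\<lambda>x. \<forall>j<F x. P x j)"
proof -
  define H where "H x s = prod_encode (Suc (fst (prod_decode s)),
    of_bool (snd (prod_decode s) = 1 \<and> P x (fst (prod_decode s))))" for x s
  have H: "(H x ^^ n) (prod_encode (0, 1)) = prod_encode (n, of_bool (\<forall>j<n. P x j))" for x n
    by (induction n) (auto simp: H_def less_Suc_eq)
  have "decidable (\<lambda>z. P (fst (prod_decode z)) (fst (prod_decode (snd (prod_decode z)))))"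
    using decidable_comp[OF assms(1), of "\<lambda>z. prod_encode (fst (prod_decode z), fst (prod_decode (snd (prod_decode z))))"]
    by (simp add: rec_intros)
  then have "decidable (\<lambda>z. snd (prod_decode (snd (prod_decode z))) = 1 \<and>
      P (fst (prod_decode z)) (fst (prod_decode (snd (prod_decode z)))))"
    by (intro rec_intros)
  then have "total_rec (\<lambda>z. H (fst (prod_decode z)) (snd (prod_decode z)))"
    unfolding H_def decidable_def by (intro rec_intros)
  then have "total_rec (\<lambda>x. snd (prod_decode ((H x ^^ F x) (prod_encode (0, 1)))))"
    by (intro rec_intros assms(2))
  then show ?thesis unfolding H decidable_def by simp
qed

text \<open>Exceptional values are removed one at a time by a conditional. It serves for tables on
  the finite alphabet.\<close>

lemma total_rec_finite_modification:
  assumes "\<And>l. l \<ge> N \<Longrightarrow> F l = c"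
  shows "total_rec F"
  using assms
proof (induction N arbitrary: F)
  case 0
  then have "F = (\<lambda>_. c)" by auto
  then show ?case by (simp add: total_rec_const)
next
  case (Suc N)
  have "total_rec (F(N := c))" by (rule Suc.IH) (use Suc.prems in auto)
  then have "total_rec (\<lambda>l. if l = N then F N else (F(N := c)) l)" by (intro rec_intros)
  then show ?case by (rule back_subst[of total_rec]) auto
qed

text \<open>Unbounded search for \<open>t\<close>; the test function is 0 exactly when
  \<open>P a t\<close> holds, and \<open>t\<close> is its first argument, as \<open>Mnf\<close>
  demands.\<close>

lemma re_set_ex:
  assumes "decidable (\<lambda>z. P (fst (prod_decode z)) (snd (prod_decode z)))"
  shows "re_set {a. \<exists>t. P a t}"
proof -
  have "total_rec (\<lambda>z. 1 - of_bool (P (fst (prod_decode z)) (snd (prod_decode z))))"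
    using assms unfolding decidable_def by (intro rec_intros)
  then have "total_rec2 (\<lambda>t a. 1 - of_bool (P (fst (prod_decode (prod_encode (a, t)))) (snd (prod_decode (prod_encode (a, t))))))"
    by (rule total_rec2_comp1) (intro total_rec2_comp2[OF total_rec2_prod_encode] total_rec2_proj)
  then obtain h where h: "\<And>t a. reval h [t, a] (1 - of_bool (P a t))"
    by (auto simp: total_rec2_def)
  have "(\<exists>t. P a t) \<longleftrightarrow> (\<exists>y. reval (Mnf h) [a] y)" for a
  proof
    assume ex: "\<exists>t. P a t"
    have "reval (Mnf h) [a] (LEAST t. P a t)"
    proof (rule reval.mn)
      show "reval h [LEAST t. P a t, a] 0"
        using h[of "LEAST t. P a t" a] LeastI_ex[OF ex] by simp
      show "\<forall>i<LEAST t. P a t. \<exists>y. reval h [i, a] y \<and> 0 < y"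
      proof (intro allI impI)
        fix i assume "i < (LEAST t. P a t)"
        then show "\<exists>y. reval h [i, a] y \<and> 0 < y"
          using h[of i a] not_less_Least by (intro exI[of _ 1]) fastforce
      qed
    qed
    then show "\<exists>y. reval (Mnf h) [a] y" by blast
  next
    assume "\<exists>y. reval (Mnf h) [a] y"
    then obtain t where "reval h [t, a] 0" by (auto elim: reval_elims)
    then have "1 - of_bool (P a t) = (0 :: nat)" using h reval_deterministic by blast
    then show "\<exists>t. P a t" by (cases "P a t") auto
  qed
  then show ?thesis unfolding re_set_def by auto
qed

section \<open>Recursive functions on lists\<close>

text \<open>The subtraction undoes the \<open>Suc\<close> with which \<open>list_encode\<close>
  marks nonempty lists; the code 0 is the empty list.\<close>

definition code_hd :: "nat \<Rightarrow> nat" where "code_hd l = fst (prod_decode (l - 1))"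
definition code_tl :: "nat \<Rightarrow> nat" where "code_tl l = snd (prod_decode (l - 1))"

lemma code_hd_Cons: "code_hd (list_encode (x # xs)) = x"
  by (simp add: code_hd_def)

lemma code_tl_list_encode: "code_tl (list_encode xs) = list_encode (tl xs)"
proof (cases xs)
  case Nil
  have "prod_decode 0 = (0, 0)" using prod_encode_inverse[of "(0, 0)"] by (simp add: prod_encode_def)
  then show ?thesis using Nil by (simp add: code_tl_def)
qed (simp add: code_tl_def)

lemma list_encode_eq_0_iff: "list_encode xs = 0 \<longleftrightarrow> xs = []"
  by (cases xs) auto

lemma length_le_list_encode: "length xs \<le> list_encode xs"
proof (induction xs)
  case (Cons x xs)
  then show ?case using le_prod_encode_2[of "list_encode xs" x] by simp
qed simp

lemma total_rec_code_hd [rec_intros]: "total_rec F \<Longrightarrow> total_rec (\<lambda>x. code_hd (F x))"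
  unfolding code_hd_def by (intro rec_intros)

lemma total_rec_code_tl [rec_intros]: "total_rec F \<Longrightarrow> total_rec (\<lambda>x. code_tl (F x))"
  unfolding code_tl_def by (intro rec_intros)

lemma funpow_code_tl: "(code_tl ^^ j) (list_encode xs) = list_encode (drop j xs)"
proof (induction j)
  case (Suc j)
  then show ?case by (simp add: code_tl_list_encode drop_Suc tl_drop del: list_encode.simps)
qed simp

text \<open>A list is no longer than its code, so \<open>j < l\<close> reaches every position, and
  the test against 0 discards positions past the end.\<close>

lemma Ball_list_decode_iff:
  "(\<forall>h\<in>set (list_decode l). P h) \<longleftrightarrow> (\<forall>j<l. (code_tl ^^ j) l \<noteq> 0 \<longrightarrow> P (code_hd ((code_tl ^^ j) l)))"
proof -
  obtain xs where l: "l = list_encode xs" by (metis list_decode_inverse)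
  have "(\<forall>j<l. (code_tl ^^ j) l \<noteq> 0 \<longrightarrow> P (code_hd ((code_tl ^^ j) l))) \<longleftrightarrow> (\<forall>j<length xs. P (xs ! j))"
  proof -
    have "code_hd (list_encode (drop j xs)) = xs ! j" if "j < length xs" for j
      using that by (simp add: Cons_nth_drop_Suc[symmetric] code_hd_Cons del: list_encode.simps)
    then show ?thesis
      using length_le_list_encode[of xs] unfolding l funpow_code_tl list_encode_eq_0_iff
      by (metis drop_eq_Nil2 leD less_le_trans not_le_imp_less)
  qed
  then show ?thesis by (simp add: l all_set_conv_all_nth)
qed

lemma decidable_Ball_list_decode [rec_intros]:
  assumes "decidable (\<lambda>z. P (fst (prod_decode z)) (snd (prod_decode z)))" "total_rec F"
  shows "decidable (\<lambda>x. \<forall>h\<in>set (list_decode (F x)). P x h)"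
proof -
  note F = total_rec_comp[OF assms(2)]
  let ?t = "\<lambda>z. (code_tl ^^ snd (prod_decode z)) (F (fst (prod_decode z)))"
  have t: "total_rec ?t" by (intro rec_intros F)
  have "decidable (\<lambda>z. P (fst (prod_decode z)) (code_hd (?t z)))"
    using decidable_comp[OF assms(1), of "\<lambda>z. prod_encode (fst (prod_decode z), code_hd (?t z))"] t
    by (simp add: rec_intros)
  then show ?thesis unfolding Ball_list_decode_iff by (intro rec_intros t assms(2))
qed

lemma decidable_mem_list_decode [rec_intros]:
  assumes "total_rec F" "total_rec G"
  shows "decidable (\<lambda>x. F x \<in> set (list_decode (G x)))"
proof -
  have "decidable (\<lambda>x. \<not> (\<forall>h\<in>set (list_decode (G x)). h \<noteq> F x))"
    by (intro rec_intros assms total_rec_comp[OF assms(1)])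
  then show ?thesis by (rule back_subst[of decidable]) auto
qed

text \<open>A loop moves heads onto an accumulator, whence the reversal. The code itself is used as
  the number of rounds: it is at least the length, and rounds on the empty list change
  nothing.\<close>

lemma total_rec_rev_map_append:
  assumes "total_rec f" "total_rec F" "total_rec G"
  shows "total_rec (\<lambda>x. list_encode (rev (map f (list_decode (F x))) @ list_decode (G x)))"
proof -
  define H where "H z = (if fst (prod_decode z) = 0 then z else
    prod_encode (code_tl (fst (prod_decode z)),
      Suc (prod_encode (f (code_hd (fst (prod_decode z))), snd (prod_decode z)))))" for z
  have H: "(H ^^ n) (prod_encode (list_encode xs, list_encode ys)) =
    prod_encode (list_encode (drop n xs), list_encode (rev (map f (take n xs)) @ ys))" for n xs ys
  proof (induction n arbitrary: xs ys)
    case (Suc n)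
    show ?case
    proof (cases xs)
      case Nil
      then show ?thesis using Suc.IH[of "[]" ys] by (simp add: H_def funpow_swap1)
    next
      case (Cons x xs')
      then have "H (prod_encode (list_encode xs, list_encode ys)) =
          prod_encode (list_encode xs', list_encode (f x # ys))"
        using code_tl_list_encode[of xs] code_hd_Cons[of x xs'] by (simp add: H_def list_encode_eq_0_iff)
      then show ?thesis using Suc.IH[of xs' "f x # ys"] Cons by (simp add: funpow_swap1 del: list_encode.simps)
    qed
  qed simp
  have "total_rec H" unfolding H_def by (intro rec_intros total_rec_comp[OF assms(1)])
  then have "total_rec (\<lambda>x. snd (prod_decode ((H ^^ F x) (prod_encode (F x, G x)))))"
    by (intro rec_intros assms(2,3) total_rec_comp2[OF total_rec2_funpow])
  moreover have "snd (prod_decode ((H ^^ l) (prod_encode (l, a)))) =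
      list_encode (rev (map f (list_decode l)) @ list_decode a)" for l a
    using H[of l "list_decode l" "list_decode a"] length_le_list_encode[of "list_decode l"] by simp
  ultimately show ?thesis by simp
qed

lemma total_rec_append_map:
  assumes "total_rec f" "total_rec F" "total_rec G"
  shows "total_rec (\<lambda>x. list_encode (list_decode (F x) @ map f (list_decode (G x))))"
proof -
  note [rec_intros] = total_rec_rev_map_append[OF total_rec_id] total_rec_rev_map_append[OF assms(1)]
  \<comment> \<open>Each list is reversed twice to restore its order.\<close>
  have "total_rec (\<lambda>x. list_encode (rev (map (\<lambda>x. x) (list_decode (list_encode (rev (map (\<lambda>x. x)
    (list_decode (F x))) @ list_decode 0)))) @ list_decode (list_encode (rev (map f (list_decode
      (list_encode (rev (map (\<lambda>x. x) (list_decode (G x))) @ list_decode 0)))) @ list_decode 0))))"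
    by (intro rec_intros assms(2,3))
  then show ?thesis by (simp add: rev_map[symmetric])
qed

lemma total_rec_append_rev_map:
  assumes "total_rec f" "total_rec F" "total_rec G"
  shows "total_rec (\<lambda>x. list_encode (list_decode (F x) @ rev (map f (list_decode (G x)))))"
proof -
  note [rec_intros] = total_rec_rev_map_append[OF total_rec_id] total_rec_rev_map_append[OF assms(1)]
  have "total_rec (\<lambda>x. list_encode (rev (map (\<lambda>x. x) (list_decode (list_encode (rev (map (\<lambda>x. x)
    (list_decode (F x))) @ list_decode 0)))) @ list_decode (list_encode (rev (map f (list_decode (G x)))
      @ list_decode 0))))"
    by (intro rec_intros assms(2,3))
  then show ?thesis by simp
qed

section \<open>Forbidden patterns of the copying subshift\<close>

text \<open>Words are coded by natural numbers. Every \<open>i\<close> is read as a valid word by replacing the letters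
  outside the alphabet by the letter \<open>0\<close>.\<close>

locale coded_words =
  fixes ss :: "'g::group_add list"
  assumes gen: "fin_sym_gen (set ss)" and nonempty: "ss \<noteq> []"
begin

definition letter :: "nat \<Rightarrow> nat" where
  "letter l = (if l < length ss then l else 0)"

definition inv_letter :: "nat \<Rightarrow> nat" where
  "inv_letter l = (SOME m. m < length ss \<and> ss ! m = - ss ! letter l)"

definition elem :: "nat \<Rightarrow> 'g" where
  "elem v = word_elem ss (list_decode v)"

definition enum :: "nat \<Rightarrow> 'g" where
  "enum i = word_elem ss (map letter (list_decode i))"

definition valid_word :: "nat \<Rightarrow> bool" where
  "valid_word v \<longleftrightarrow> (\<forall>l\<in>set (list_decode v). l < length ss)"

text \<open>This and \<open>append_inv\<close> mirror translation by \<open>enum i\<close> and by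
  its inverse on formal words; equality in the group is never tested.\<close>

definition append_word :: "nat \<Rightarrow> nat \<Rightarrow> nat" where
  "append_word v i = list_encode (list_decode v @ map letter (list_decode i))"

definition append_inv :: "nat \<Rightarrow> nat \<Rightarrow> nat" where
  "append_inv v i = list_encode (list_decode v @ rev (map inv_letter (list_decode i)))"

lemma letter_less: "letter l < length ss"
  using nonempty by (simp add: letter_def)

lemma inv_letter: "inv_letter l < length ss" "ss ! inv_letter l = - ss ! letter l"
proof -
  have "- ss ! letter l \<in> set ss"
    using gen letter_less[of l] by (auto simp: fin_sym_gen_def symmetric_set_def)
  then have "\<exists>m. m < length ss \<and> ss ! m = - ss ! letter l" by (metis in_set_conv_nth)
  from someI_ex[OF this] show "inv_letter l < length ss" "ss ! inv_letter l = - ss ! letter l"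
    by (simp_all add: inv_letter_def)
qed

lemma elem_0: "elem 0 = 0"
  by (simp add: elem_def word_elem_def)

lemma elem_append_word: "elem (append_word v i) = elem v + enum i"
  by (simp add: elem_def enum_def append_word_def word_elem_def)

lemma elem_append_inv: "elem (append_inv v i) = elem v - enum i"
proof -
  have "sum_list (map ((!) ss) (rev (map inv_letter w))) = - sum_list (map ((!) ss) (map letter w))" for w
    by (induction w) (simp_all add: inv_letter minus_add)
  then show ?thesis by (simp add: elem_def enum_def append_inv_def word_elem_def)
qed

lemma valid_word_0: "valid_word 0"
  by (simp add: valid_word_def)

lemma valid_word_append_word: "valid_word v \<Longrightarrow> valid_word (append_word v i)"
  by (auto simp: valid_word_def append_word_def letter_less)

lemma valid_word_append_inv: "valid_word v \<Longrightarrow> valid_word (append_inv v i)"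
  by (auto simp: valid_word_def append_inv_def inv_letter)

text \<open>Turns validity into an equation between recursive functions, hence into a decidable
  condition.\<close>

lemma valid_word_iff: "valid_word v \<longleftrightarrow> append_word 0 v = v"
proof -
  have "map letter w = w \<longleftrightarrow> (\<forall>l\<in>set w. l < length ss)" for w
    using letter_less by (induction w) (auto simp: letter_def split: if_splits)
  moreover have "append_word 0 v = v \<longleftrightarrow> map letter (list_decode v) = list_decode v"
    unfolding append_word_def by (metis append_Nil list_decode.simps(1) list_decode_inverse list_encode_inverse)
  ultimately show ?thesis by (simp add: valid_word_def)
qed

lemma range_enum: "range enum = UNIV"
proof -
  have "\<exists>i. g = enum i" for g
  proof -
    have "set ss \<union> uminus ` set ss = set ss" using gen by (auto simp: fin_sym_gen_def symmetric_set_def)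
    then obtain xs where xs: "set xs \<subseteq> set ss" "g = sum_list xs"
      using gen unfolding fin_sym_gen_def generates_def by metis
    have "\<exists>w. (\<forall>l\<in>set w. l < length ss) \<and> xs = map ((!) ss) w"
      using xs(1)
    proof (induction xs)
      case (Cons x xs)
      then obtain w where "\<forall>l\<in>set w. l < length ss" "xs = map ((!) ss) w" by auto
      moreover obtain m where "m < length ss" "x = ss ! m" using Cons.prems by (auto simp: in_set_conv_nth)
      ultimately show ?case by (intro exI[of _ "m # w"]) auto
    qed simp
    then obtain w where w: "\<forall>l\<in>set w. l < length ss" "xs = map ((!) ss) w" by blast
    then have "map letter w = w" by (simp add: letter_def map_idI)
    then have "g = enum (list_encode w)" by (simp add: enum_def word_elem_def xs(2) w(2))
    then show ?thesis by blast
  qed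
  then show ?thesis by blast
qed

lemma total_rec_letter: "total_rec letter"
  by (rule total_rec_finite_modification[of "length ss" _ 0]) (simp add: letter_def)

text \<open>Although defined by choice, \<open>inv_letter\<close> is constant beyond the alphabet,
  because \<open>letter\<close> is.\<close>

lemma total_rec_inv_letter: "total_rec inv_letter"
  by (rule total_rec_finite_modification[of "length ss" _ "inv_letter (length ss)"])
    (simp add: inv_letter_def letter_def)

lemma total_rec_append_word: "total_rec F \<Longrightarrow> total_rec G \<Longrightarrow> total_rec (\<lambda>x. append_word (F x) (G x))"
  unfolding append_word_def by (rule total_rec_append_map[OF total_rec_letter])

lemma total_rec_append_inv: "total_rec F \<Longrightarrow> total_rec G \<Longrightarrow> total_rec (\<lambda>x. append_inv (F x) (G x))"
  unfolding append_inv_def by (rule total_rec_append_rev_map[OF total_rec_inv_letter])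

text \<open>The same predicate reads certificates: there the first slot holds the truth value and
  the second the code of \<open>(v, i)\<close>.\<close>

definition entry :: "nat \<Rightarrow> nat \<Rightarrow> nat \<Rightarrow> bool" where
  "entry a v \<sigma> \<longleftrightarrow> prod_encode (v, \<sigma>) \<in> set (list_decode a)"

lemma valid_coding_iff:
  "valid_coding ss a \<longleftrightarrow> (\<forall>c\<in>set (list_decode a). append_word 0 (fst (prod_decode c)) = fst (prod_decode c))"
  unfolding valid_word_iff[symmetric]
  by (auto simp: valid_coding_def decode_coding_def valid_word_def)

lemma in_shifted_coding_cyl_iff:
  "in_shifted_coding_cyl ss x g a \<longleftrightarrow> (\<forall>v \<sigma>. entry a v \<sigma> \<longrightarrow> x (g + elem v) = \<sigma>)"
proof -
  have "in_shifted_coding_cyl ss x g a \<longleftrightarrow>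
      (\<forall>(w, \<sigma>)\<in>set (decode_coding a). x (g + word_elem ss w) = \<sigma>)"
  proof
    assume "\<forall>(w, \<sigma>)\<in>set (decode_coding a). x (g + word_elem ss w) = \<sigma>"
    moreover have "x = shift g (\<lambda>h. x (g + h))" by (simp add: shift_def add.assoc[symmetric])
    ultimately show "in_shifted_coding_cyl ss x g a" unfolding in_shifted_coding_cyl_def by blast
  qed (auto simp: in_shifted_coding_cyl_def shift_def add.assoc[symmetric])
  also have "\<dots> \<longleftrightarrow> (\<forall>c\<in>set (list_decode a). x (g + elem (fst (prod_decode c))) = snd (prod_decode c))"
    by (simp add: decode_coding_def elem_def)
  also have "\<dots> \<longleftrightarrow> (\<forall>v \<sigma>. entry a v \<sigma> \<longrightarrow> x (g + elem v) = \<sigma>)"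
    unfolding entry_def
    by (metis fst_conv snd_conv prod.collapse prod_decode_inverse prod_encode_inverse)
  finally show ?thesis .
qed

text \<open>A certificate is a list \<open>L\<close> of triples \<open>(b, v, i)\<close>, each asserting that the truth value of
  \<open>greedy enum A B (elem v) i\<close> is \<open>b\<close>. Each triple has to be justified by the pattern \<open>a\<close> and by
  triples with smaller \<open>i\<close>, so that there is no circularity.\<close>

definition justified :: "nat \<Rightarrow> nat \<Rightarrow> nat \<Rightarrow> nat \<Rightarrow> nat \<Rightarrow> bool" where
  "justified a L b v i \<longleftrightarrow>
     b = 1 \<and> (entry a v 1 \<or> entry a v 2) \<and> (entry a (append_word v i) 3 \<or> entry a (append_word v i) 4) \<and>
       (\<forall>j<i. entry L 0 (prod_encode (v, j)) \<and> entry L 0 (prod_encode (append_inv (append_word v i) j, j))) \<or>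
     b = 0 \<and> (entry a v 0 \<or> entry a v 3 \<or> entry a v 4 \<or>
       entry a (append_word v i) 0 \<or> entry a (append_word v i) 1 \<or> entry a (append_word v i) 2 \<or>
       \<not> (\<forall>j<i. \<not> entry L 1 (prod_encode (v, j)) \<and> \<not> entry L 1 (prod_encode (append_inv (append_word v i) j, j))))"

definition certificate :: "nat \<Rightarrow> nat \<Rightarrow> nat \<Rightarrow> bool" where
  "certificate a L i \<longleftrightarrow>
     (\<forall>q\<in>set (list_decode L). justified a L (fst (prod_decode q))
        (fst (prod_decode (snd (prod_decode q)))) (snd (prod_decode (snd (prod_decode q))))) \<and>
     entry L 1 (prod_encode (0, i)) \<and>
     (entry a 0 1 \<and> entry a (append_word 0 i) 4 \<or> entry a 0 2 \<and> entry a (append_word 0 i) 3)"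

text \<open>One number \<open>t\<close> codes both the certificate and the stage, to fit the form of
  \<open>re_set_ex\<close>.\<close>

definition bad_codings :: "nat set" where
  "bad_codings = {a. \<exists>t. valid_coding ss a \<and> certificate a (fst (prod_decode t)) (snd (prod_decode t))}"

lemma decidable_entry:
  "total_rec A \<Longrightarrow> total_rec V \<Longrightarrow> total_rec T \<Longrightarrow> decidable (\<lambda>x. entry (A x) (V x) (T x))"
  unfolding entry_def by (intro rec_intros)

lemma decidable_justified:
  assumes "total_rec A" "total_rec L" "total_rec B" "total_rec V" "total_rec I"
  shows "decidable (\<lambda>x. justified (A x) (L x) (B x) (V x) (I x))"
  unfolding justified_def
  by (intro rec_intros decidable_entry total_rec_append_word total_rec_append_inv assms
      assms[THEN total_rec_comp])

lemma re_set_bad_codings: "re_set bad_codings"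
  unfolding bad_codings_def
proof (rule re_set_ex)
  show "decidable (\<lambda>z. valid_coding ss (fst (prod_decode z)) \<and>
      certificate (fst (prod_decode z)) (fst (prod_decode (snd (prod_decode z)))) (snd (prod_decode (snd (prod_decode z)))))"
    unfolding valid_coding_iff certificate_def
    by (intro rec_intros decidable_entry decidable_justified total_rec_append_word)
qed

lemma justified_entry:
  assumes "certificate a L i0" "entry L b (prod_encode (v, i))"
  shows "justified a L b v i"
  using assms unfolding certificate_def entry_def by force

text \<open>Induction on the stage: a triple is justified by symbols that \<open>x\<close> really
  carries and by triples of smaller stage, which are true by induction.\<close>

lemma certificate_sound:
  assumes cert: "certificate a L i0" and cyl: "in_shifted_coding_cyl ss x g a"
    and "entry L b (prod_encode (v, i))"
  shows "b = of_bool (greedy enum (src x) (tgt x) (g + elem v) i)"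
  using assms(3)
proof (induction i arbitrary: b v rule: less_induct)
  case (less i)
  have x: "\<And>v \<sigma>. entry a v \<sigma> \<Longrightarrow> x (g + elem v) = \<sigma>" using cyl by (simp add: in_shifted_coding_cyl_iff)
  have fw: "g + elem (append_word v i) = g + elem v + enum i" by (simp add: elem_append_word add.assoc)
  have bk: "g + elem (append_inv (append_word v i) j) = g + elem v + enum i - enum j" for j
    by (simp add: elem_append_word elem_append_inv add.assoc add_diff_eq)
  note greedy = greedy.simps[of enum "src x" "tgt x" "g + elem v" i]
  consider (pos) "b = 1" "entry a v 1 \<or> entry a v 2"
      "entry a (append_word v i) 3 \<or> entry a (append_word v i) 4"
      "\<forall>j<i. entry L 0 (prod_encode (v, j)) \<and> entry L 0 (prod_encode (append_inv (append_word v i) j, j))"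
    | (src) "b = 0" "entry a v 0 \<or> entry a v 3 \<or> entry a v 4"
    | (tgt) "b = 0" "entry a (append_word v i) 0 \<or> entry a (append_word v i) 1 \<or> entry a (append_word v i) 2"
    | (neg) j where "b = 0" "j < i"
      "entry L 1 (prod_encode (v, j)) \<or> entry L 1 (prod_encode (append_inv (append_word v i) j, j))"
    using justified_entry[OF cert less.prems] unfolding justified_def by blast
  then show ?case
  proof cases
    case pos
    have "g + elem v \<in> src x" using pos(2) x by (auto simp: src_def)
    moreover have "g + elem v + enum i \<in> tgt x" using pos(3) x[of "append_word v i"] by (auto simp: tgt_def fw)
    moreover have "\<not> greedy enum (src x) (tgt x) (g + elem v) j"
      "\<not> greedy enum (src x) (tgt x) (g + elem v + enum i - enum j) j" if "j < i" for j
      using less.IH[OF that, of 0] pos(4) that by (force simp: bk[symmetric])+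
    ultimately show ?thesis using pos(1) by (simp add: greedy)
  next
    case src
    then have "g + elem v \<notin> src x" using x by (auto simp: src_def)
    then show ?thesis using src(1) by (simp add: greedy)
  next
    case tgt
    then have "x (g + elem v + enum i) \<in> {0, 1, 2}"
      using x[of "append_word v i" 0] x[of "append_word v i" 1] x[of "append_word v i" 2] by (auto simp: fw)
    then have "g + elem v + enum i \<notin> tgt x" by (auto simp: tgt_def)
    then show ?thesis using tgt(1) by (simp add: greedy)
  next
    case neg
    have "greedy enum (src x) (tgt x) (g + elem u) j" if "entry L 1 (prod_encode (u, j))" for u
      using less.IH[OF neg(2) that] by (simp add: of_bool_def split: if_splits)
    with neg(3) have "greedy enum (src x) (tgt x) (g + elem v) j \<or>
        greedy enum (src x) (tgt x) (g + elem v + enum i - enum j) j"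
      unfolding bk[symmetric] by blast
    then have "\<not> greedy enum (src x) (tgt x) (g + elem v) i" using neg(2) greedy by blast
    then show ?thesis using neg(1) by simp
  qed
qed

lemma bad_codings_sound:
  assumes "a \<in> bad_codings" "in_shifted_coding_cyl ss x g a"
  shows "x \<notin> copy_shift enum"
proof
  assume x: "x \<in> copy_shift enum"
  obtain L i where cert: "certificate a L i" using assms(1) by (auto simp: bad_codings_def)
  have "1 = (of_bool (greedy enum (src x) (tgt x) (g + elem 0) i) :: nat)"
    using cert by (intro certificate_sound[OF cert assms(2)]) (simp add: certificate_def)
  then have "greedy enum (src x) (tgt x) g i" by (simp add: elem_0 of_bool_def split: if_splits)
  then have "x (g + enum i) = x g + 2" using x by (simp add: copy_shift_def)
  moreover have e: "\<And>v \<sigma>. entry a v \<sigma> \<Longrightarrow> x (g + elem v) = \<sigma>"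
    using assms(2) by (simp add: in_shifted_coding_cyl_iff)
  have "x g = 1 \<and> x (g + enum i) = 4 \<or> x g = 2 \<and> x (g + enum i) = 3"
    using cert e[of 0] e[of "append_word 0 i"] by (auto simp: certificate_def elem_0 elem_append_word)
  ultimately show False by auto
qed

section \<open>Every violation has a certificate\<close>

definition closed_facts :: "(nat \<times> nat) set \<Rightarrow> bool" where
  "closed_facts P \<longleftrightarrow> (\<forall>(v, i)\<in>P. valid_word v \<and>
     (\<forall>j<i. (v, j) \<in> P \<and> (append_inv (append_word v i) j, j) \<in> P))"

text \<open>A query at stage \<open>i\<close> calls two queries for each \<open>j < i\<close>, so
  the call tree has finite depth and finite branching.\<close>

lemma finite_closed_facts:
  assumes "valid_word v"
  shows "\<exists>P. finite P \<and> (v, i) \<in> P \<and> closed_facts P"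
  using assms
proof (induction i arbitrary: v rule: less_induct)
  case (less i)
  then obtain P where P: "\<And>j u. j < i \<Longrightarrow> valid_word u \<Longrightarrow> finite (P j u) \<and> (u, j) \<in> P j u \<and> closed_facts (P j u)"
    by metis
  let ?w = "append_inv (append_word v i)"
  define Q where "Q = (\<Union>j<i. P j v \<union> P j (?w j))"
  have val: "valid_word (?w j)" for j
    by (intro valid_word_append_inv valid_word_append_word less.prems)
  have "finite (insert (v, i) Q)" using P less.prems val by (auto simp: Q_def)
  moreover have "closed_facts Q"
    unfolding closed_facts_def
  proof (clarify)
    fix u k assume "(u, k) \<in> Q"
    then obtain j w where j: "j < i" "valid_word w" "(u, k) \<in> P j w" "P j w \<subseteq> Q"
      unfolding Q_def using less.prems val by auto
    then have "closed_facts (P j w)" using P by blast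
    then show "valid_word u \<and> (\<forall>j<k. (u, j) \<in> Q \<and> (append_inv (append_word u k) j, j) \<in> Q)"
      using j(3,4) unfolding closed_facts_def by blast
  qed
  moreover have "(v, j) \<in> Q" "(?w j, j) \<in> Q" if "j < i" for j
    using P[OF that less.prems] P[OF that val[of j]] that by (auto simp: Q_def)
  ultimately have "closed_facts (insert (v, i) Q)"
    using less.prems unfolding closed_facts_def by auto
  then show ?case using \<open>finite (insert (v, i) Q)\<close> by blast
qed

text \<open>From a violated match, the pattern records the symbols of \<open>x\<close> at both ends
  of every queried pair, and the certificate records the true answers to the queries.\<close>

lemma bad_codings_complete:
  assumes x: "x \<in> conf 5" "x \<notin> copy_shift enum"
  shows "\<exists>a\<in>bad_codings. \<exists>g. in_shifted_coding_cyl ss x g a"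
proof -
  obtain g i where gr: "greedy enum (src x) (tgt x) g i" and ne: "x (g + enum i) \<noteq> x g + 2"
    using x by (auto simp: copy_shift_def)
  obtain P where "finite P" "(0, i) \<in> P" "closed_facts P"
    using finite_closed_facts[OF valid_word_0, of i] by blast
  then have P: "finite P" "(0, i) \<in> P" "\<And>v i. (v, i) \<in> P \<Longrightarrow> valid_word v"
    "\<And>v i j. (v, i) \<in> P \<Longrightarrow> j < i \<Longrightarrow> (v, j) \<in> P"
    "\<And>v i j. (v, i) \<in> P \<Longrightarrow> j < i \<Longrightarrow> (append_inv (append_word v i) j, j) \<in> P"
    unfolding closed_facts_def by auto
  define V where "V = fst ` P \<union> (\<lambda>(v, i). append_word v i) ` P"
  obtain as where as: "set as = (\<lambda>v. prod_encode (v, x (g + elem v))) ` V"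
    using finite_list[of "(\<lambda>v. prod_encode (v, x (g + elem v))) ` V"] P(1) by (auto simp: V_def)
  define a where "a = list_encode as"
  define G where "G v i \<longleftrightarrow> greedy enum (src x) (tgt x) (g + elem v) i" for v i
  obtain Ls where Ls: "set Ls = (\<lambda>(v, i). prod_encode (of_bool (G v i), prod_encode (v, i))) ` P"
    using finite_list[of "(\<lambda>(v, i). prod_encode (of_bool (G v i), prod_encode (v, i))) ` P"] P(1) by auto
  define L where "L = list_encode Ls"
  have a: "entry a v \<sigma> \<longleftrightarrow> v \<in> V \<and> \<sigma> = x (g + elem v)" for v \<sigma>
    by (auto simp: entry_def a_def as)
  have L: "entry L b (prod_encode (v, i)) \<longleftrightarrow> (v, i) \<in> P \<and> b = of_bool (G v i)" for b v i
    by (auto simp: entry_def L_def Ls image_iff intro!: bexI[of _ "(v, i)"])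
  have V: "v \<in> V" "append_word v i \<in> V" if "(v, i) \<in> P" for v i
    using that by (force simp: V_def)+
  \<comment> \<open>A negative answer is justified by an explicit symbol, so the symbols that are
    not sources or not targets must be listed.\<close>
  have less5: "x h = 0 \<or> x h = 1 \<or> x h = 2 \<or> x h = 3 \<or> x h = 4" for h
  proof -
    have "x h < 5" using x(1) by (simp add: conf_def)
    then show ?thesis by linarith
  qed
  have just: "justified a L (of_bool (G v i)) v i" if vi: "(v, i) \<in> P" for v i
  proof -
    have fw: "g + elem (append_word v i) = g + elem v + enum i" by (simp add: elem_append_word add.assoc)
    have "g + elem (append_inv (append_word v i) j) = g + elem v + enum i - enum j" for j
      by (simp add: elem_append_word elem_append_inv add.assoc add_diff_eq)
    then have G: "G v i \<longleftrightarrow> g + elem v \<in> src x \<and> g + elem (append_word v i) \<in> tgt x \<and> (\<forall>j<i. \<not> G v j) \<and>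
        (\<forall>j<i. \<not> G (append_inv (append_word v i) j) j)"
      unfolding G_def by (subst greedy.simps) (auto simp: fw)
    show ?thesis
    proof (cases "G v i")
      case True
      then show ?thesis
        using G V[OF vi] P(4,5)[OF vi] unfolding justified_def a L by (auto simp: src_def tgt_def)
    next
      \<comment> \<open>A pair fails to be joined for want of a source, for want of a target, or
        because an end was joined earlier; these are the negative clauses of
        \<open>justified\<close>.\<close>
      case False
      then consider "g + elem v \<notin> src x" | "g + elem (append_word v i) \<notin> tgt x"
        | j where "j < i" "G v j \<or> G (append_inv (append_word v i) j) j"
        using G by blast
      then show ?thesis
      proof cases
        case 1
        then show ?thesis
          using False V[OF vi] less5[of "g + elem v"] unfolding justified_def a by (auto simp: src_def)
      next
        case 2
        then show ?thesis
          using False V[OF vi] less5[of "g + elem (append_word v i)"] unfolding justified_def a by (auto simp: tgt_def)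
      next
        case 3
        then show ?thesis
          using False P(4,5)[OF vi 3(1)] unfolding justified_def L by auto
      qed
    qed
  qed
  have "certificate a L i"
    unfolding certificate_def
  proof (intro conjI)
    show "\<forall>q\<in>set (list_decode L). justified a L (fst (prod_decode q))
        (fst (prod_decode (snd (prod_decode q)))) (snd (prod_decode (snd (prod_decode q))))"
      using just by (auto simp: L_def Ls)
    show "entry L 1 (prod_encode (0, i))" using P(2) gr by (simp add: L G_def elem_0)
    have "g \<in> src x" "g + enum i \<in> tgt x" using greedyD[OF gr] .
    then show "entry a 0 1 \<and> entry a (append_word 0 i) 4 \<or> entry a 0 2 \<and> entry a (append_word 0 i) 3"
      using V[OF P(2)] ne by (auto simp: a elem_0 elem_append_word src_def tgt_def)
  qed
  moreover have "valid_word v" if "v \<in> V" for v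
    using that P(3) by (auto simp: V_def intro: valid_word_append_word)
  then have "valid_coding ss a"
    unfolding valid_coding_iff valid_word_iff[symmetric] by (auto simp: a_def as)
  ultimately have "a \<in> bad_codings"
    unfolding bad_codings_def by (auto intro!: exI[of _ "prod_encode (L, i)"])
  moreover have "in_shifted_coding_cyl ss x g a" by (simp add: in_shifted_coding_cyl_iff a)
  ultimately show ?thesis by blast
qed

lemma eff_closed_copy_shift: "eff_closed_by_patterns ss 5 (copy_shift enum)"
  unfolding eff_closed_by_patterns_def
proof (intro exI conjI)
  show "re_set bad_codings" by (rule re_set_bad_codings)
  show "\<forall>a\<in>bad_codings. valid_coding ss a" by (auto simp: bad_codings_def)
  show "copy_shift enum = conf 5 - (\<Union>a\<in>bad_codings. \<Union>g. {x. in_shifted_coding_cyl ss x g a})"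
  proof (rule set_eqI)
    fix x
    have "x \<in> copy_shift enum \<Longrightarrow> x \<in> conf 5" by (simp add: copy_shift_def)
    then show "x \<in> copy_shift enum \<longleftrightarrow>
        x \<in> conf 5 - (\<Union>a\<in>bad_codings. \<Union>g. {x. in_shifted_coding_cyl ss x g a})"
      using bad_codings_sound bad_codings_complete[of x] by (cases "x \<in> copy_shift enum") auto
  qed
qed

end

text \<open>A UFO contains two disjoint nonempty sets, so the group has at least two elements. This
  excludes the empty alphabet, in which the default letter \<open>0\<close> of \<open>letter\<close>
  would not exist.\<close>

lemma not_extraterrestrial_trivial:
  assumes "\<And>g :: 'g::group_add. g = 0"
  shows "\<not> extraterrestrial_group TYPE('g)"
proof
  assume "extraterrestrial_group TYPE('g)"
  then obtain S :: "'g set" where S: "extraterrestrial_graph (cayley_adj S)"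
    by (auto simp: extraterrestrial_group_def)
  then obtain k U F B where "is_UFO (cayley_adj S) 0 k 0 U F B"
    unfolding extraterrestrial_graph_def by blast
  then have "U \<noteq> {}" "U \<inter> B = {}" "\<exists>f. bij_betw f U B" by (auto simp: is_UFO_def)
  then have "B \<noteq> {}" by (auto simp: bij_betw_def)
  with \<open>U \<noteq> {}\<close> have "0 \<in> U" "0 \<in> B" using assms by (metis ex_in_conv)+
  with \<open>U \<inter> B = {}\<close> show False by blast
qed

theorem theoremB:
  fixes ss :: "'g::group_add list"
  assumes "finitely_generated TYPE('g)"
    and "extraterrestrial_group TYPE('g)"
    and "distinct ss" and "fin_sym_gen (set ss)"
  shows "\<exists>n::nat. \<exists>X::('g \<Rightarrow> nat) set. subshift n X \<and> eff_closed_by_patterns ss n X \<and>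
           \<not> (\<exists>m::nat. \<exists>Y::('g \<Rightarrow> nat) set. \<exists>\<phi>. SFT m Y \<and> factor_map Y X \<phi>)"
proof -
  have "ss \<noteq> []"
  proof
    assume "ss = []"
    then have "g = 0" for g :: 'g using assms(4) by (auto simp: fin_sym_gen_def generates_def)
    then show False using not_extraterrestrial_trivial assms(2) by blast
  qed
  then interpret coded_words ss using assms(4) by unfold_locales
  show ?thesis
    using subshift_copy_shift eff_closed_copy_shift copy_shift_not_sofic[OF range_enum assms(2)] by blast
qed

end
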